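(* Let $w\in S_n$ and let $k\in\{1,2\}$ with $k\le n-1$. Put $\partial_1^{\mathbf{q}}=\partial_1$ and $\partial_2^{\mathbf{q}}=\partial_2(1-q_{12}\partial_1\partial_2)$, operators on $R_n=\mathbb{Z}[x_1,\ldots,x_n,q_{ij}\mid 1\le i<j\le n]$. Then $$\partial_k^{\mathbf{q}}(\mathfrak{S}_w^{\mathbf{q}})=\begin{cases}\mathfrak{S}_{ws_k}^{\mathbf{q}}&\text{if }w(k)>w(k+1);\\0&\text{if }w(k)<w(k+1).\end{cases}$$
   Context: Fix $n$; $s_k\in S_n$ is the transposition of $k$ and $k+1$. Convention: $q_{ij}=0$ unless $1\le i<j\le n$. Products of operators are compositions, and $q_{12}$ acts by multiplication. Quantized elementary polynomials: for $0\le j\le n$ let $M_j$ be the $j\times j$ matrix with diagonal entries $x_1,\ldots,x_j$, with $(a,b)$ entry $q_{ab}$ for $a<b$, with entries $-1$ in positions $(a+1,a)$, and $0$ elsewhere. Define $E_i^{(j)}\in R_n$ by $\det(tI_j-M_j)=\sum_{i=0}^{j}(-1)^iE_i^{(j)}t^{j-i}$, with $E_0^{(j)}=1$ and $E_i^{(j)}=0$ unless $0\le i\le j$. Action and divided differences on $R_n$: for $1\le k\le n-1$, $s_k$ acts on $R_n$ by the ring automorphism that swaps $x_k$ and $x_{k+1}$, fixes the other $x_i$, and satisfies, for $1\le i<j\le n$, $s_k(q_{ij})=q_{ij}-q_{i\,j-1}(x_{j-1}-x_j)$ if $k=j-1$; $s_k(q_{ij})=q_{ij}+q_{i+1\,j}(x_i-x_{i+1})$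 if $k=i$; $s_k(q_{ij})=q_{ij}$ otherwise (so $s_k(q_{i\,i+1})=q_{i\,i+1}$ for all $k$). This defines an action of $S_n$, and $\partial_k(F)=\dfrac{F-s_k(F)}{x_k-x_{k+1}}\in R_n$ for $F\in R_n$. Schubert polynomials: $\mathfrak{S}_w\in\mathbb{Z}[x_1,\ldots,x_n]$, $w\in S_n$, are defined by $\mathfrak{S}_{w_0}=x_1^{n-1}x_2^{n-2}\cdots x_{n-1}$ for $w_0(i)=n+1-i$, and $\mathfrak{S}_{ws_k}=\partial_k(\mathfrak{S}_w)$ whenever $w(k)>w(k+1)$ (with $(ws_k)(i)=w(s_k(i))$ and the usual $\partial_k$ on $\mathbb{Z}[x_1,\ldots,x_n]$). With $e_i^{(j)}=e_i(x_1,\ldots,x_j)$, one can write uniquely $\mathfrak{S}_w=\sum c_{i_1,\ldots,i_{n-1}}e_{i_1}^{(1)}\cdots e_{i_{n-1}}^{(n-1)}$ with $c_{i_1,\ldots,i_{n-1}}\in\mathbb{Z}$, $0\le i_p\le p$. Then $\mathfrak{S}_w^{\mathbf{q}}=\sum c_{i_1,\ldots,i_{n-1}}E_{i_1}^{(1)}\cdots E_{i_{n-1}}^{(n-1)}$. *)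

theory Defs
  imports
    "HOL-Library.Poly_Mapping"
    "HOL-Library.Countable"
    "HOL-Library.FuncSet"
    "HOL-Combinatorics.Permutations"
    "HOL-Combinatorics.Transposition"
    "Jordan_Normal_Form.Char_Poly"
begin

section \<open>The polynomial ring \<open>R\<^sub>n\<close>\<close>

text \<open>
  All rings \<open>R\<^sub>n\<close> live inside one polynomial ring over the integers, in variables
  \<open>X i\<close> and \<open>Q i j\<close> with arbitrary indices; \<open>R\<^sub>n\<close> is the subring \<open>qring n\<close>.
\<close>

datatype qvar = X nat | Q nat nat

instance qvar :: countable
  by countable_datatype

text \<open>
  The order on variables has no mathematical meaning. It is there because the library
  derives the absence of zero divisors from an order on the exponents.
\<close>

instantiation qvar :: linorder
begin

definition less_eq_qvar :: "qvar \<Rightarrow> qvar \<Rightarrow> bool"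
  where "less_eq_qvar v w \<longleftrightarrow> to_nat v \<le> to_nat w"

definition less_qvar :: "qvar \<Rightarrow> qvar \<Rightarrow> bool"
  where "less_qvar v w \<longleftrightarrow> to_nat v < to_nat w"

instance
  by standard (auto simp: less_eq_qvar_def less_qvar_def)

end

type_synonym qpoly = "(qvar \<Rightarrow>\<^sub>0 nat) \<Rightarrow>\<^sub>0 int"

definition var :: "qvar \<Rightarrow> qpoly"
  where "var v = Poly_Mapping.single (Poly_Mapping.single v 1) 1"

definition xx :: "nat \<Rightarrow> qpoly"
  where "xx i = var (X i)"

definition qq :: "nat \<Rightarrow> nat \<Rightarrow> nat \<Rightarrow> qpoly"
  where "qq n i j = (if 1 \<le> i \<and> i < j \<and> j \<le> n then var (Q i j) else 0)"

definition qvars :: "nat \<Rightarrow> qvar set"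
  where "qvars n = {X i | i. 1 \<le> i \<and> i \<le> n} \<union> {Q i j | i j. 1 \<le> i \<and> i < j \<and> j \<le> n}"

definition qring :: "nat \<Rightarrow> qpoly set"
  where "qring n = {F. \<forall>m \<in> Poly_Mapping.keys F. Poly_Mapping.keys m \<subseteq> qvars n}"

definition subst :: "(qvar \<Rightarrow> qpoly) \<Rightarrow> qpoly \<Rightarrow> qpoly"
  where "subst f F = (\<Sum>m \<in> Poly_Mapping.keys F.
           of_int (Poly_Mapping.lookup F m) *
           (\<Prod>v \<in> Poly_Mapping.keys m. f v ^ Poly_Mapping.lookup m v))"


section \<open>Quantized elementary polynomials\<close>

text \<open>Matrices are indexed from \<open>0\<close>, hence the shift by one.\<close>

definition qmatrix :: "nat \<Rightarrow> nat \<Rightarrow> qpoly mat"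
  where "qmatrix n j = mat j j (\<lambda>(a, b).
           if a = b then xx (a + 1)
           else if a < b then qq n (a + 1) (b + 1)
           else if a = b + 1 then - 1
           else 0)"

text \<open>
  \<open>qelem n j i\<close> is \<open>E\<^sub>i\<close> for the matrix of size \<open>j\<close>, that is, the coefficient extracted from
  the expansion of the characteristic polynomial in \<open>char_poly_qmatrix\<close> below.
\<close>

definition qelem :: "nat \<Rightarrow> nat \<Rightarrow> nat \<Rightarrow> qpoly"
  where "qelem n j i = (if i \<le> j then (- 1) ^ i * coeff (char_poly (qmatrix n j)) (j - i) else 0)"

lemma char_poly_qmatrix:
  "char_poly (qmatrix n j) = (\<Sum>i = 0..j. monom ((- 1) ^ i * qelem n j i) (j - i))"
proof -
  have carr: "qmatrix n j \<in> carrier_mat j j"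
    by (simp add: qmatrix_def)
  have "char_poly (qmatrix n j) = (\<Sum>i\<le>j. monom (coeff (char_poly (qmatrix n j)) i) i)"
    using degree_monic_char_poly[OF carr] poly_as_sum_of_monoms by metis
  also have "\<dots> = (\<Sum>i = 0..j. monom (coeff (char_poly (qmatrix n j)) (j - i)) (j - i))"
    by (rule sum.reindex_bij_witness[where i = "\<lambda>i. j - i" and j = "\<lambda>i. j - i"]) auto
  also have "\<dots> = (\<Sum>i = 0..j. monom ((- 1) ^ i * qelem n j i) (j - i))"
    by (rule sum.cong)
       (auto simp: qelem_def mult.assoc[symmetric] power_mult_distrib[symmetric])
  finally show ?thesis .
qed

lemma qelem_0: "qelem n j 0 = 1"
proof -
  have "qmatrix n j \<in> carrier_mat j j"
    by (simp add: qmatrix_def)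
  then show ?thesis
    using degree_monic_char_poly[of "qmatrix n j" j] by (simp add: qelem_def)
qed

definition elem :: "nat \<Rightarrow> nat \<Rightarrow> qpoly"
  where "elem j i = (\<Sum>A \<in> {A. A \<subseteq> {1..j} \<and> card A = i}. \<Prod>a \<in> A. xx a)"


section \<open>Divided differences\<close>

abbreviation adj_transp :: "nat \<Rightarrow> nat \<Rightarrow> nat"
  where "adj_transp k \<equiv> Transposition.transpose k (k + 1)"

fun qact_var :: "nat \<Rightarrow> nat \<Rightarrow> qvar \<Rightarrow> qpoly"
  where
    "qact_var n k (X i) = xx (adj_transp k i)"
  | "qact_var n k (Q i j) =
       (if k + 1 = j then qq n i j - qq n i (j - 1) * (xx (j - 1) - xx j)
        else if k = i then qq n i j + qq n (i + 1) j * (xx i - xx (i + 1))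
        else qq n i j)"

definition qact :: "nat \<Rightarrow> nat \<Rightarrow> qpoly \<Rightarrow> qpoly"
  where "qact n k = subst (qact_var n k)"

fun xact_var :: "nat \<Rightarrow> qvar \<Rightarrow> qpoly"
  where
    "xact_var k (X i) = xx (adj_transp k i)"
  | "xact_var k (Q i j) = var (Q i j)"

definition xact :: "nat \<Rightarrow> qpoly \<Rightarrow> qpoly"
  where "xact k = subst (xact_var k)"

definition divdiff :: "nat \<Rightarrow> (qpoly \<Rightarrow> qpoly) \<Rightarrow> nat \<Rightarrow> qpoly \<Rightarrow> qpoly"
  where "divdiff n s k F = (THE G. G \<in> qring n \<and> (xx k - xx (k + 1)) * G = F - s F)"

text \<open>
  \<open>pd\<close> is the divided difference on \<open>R\<^sub>n\<close>, and \<open>xpd\<close> is the usual one, which is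
  applied only to polynomials in \<open>x\<^sub>1, \<dots>, x\<^sub>n\<close>.
\<close>

definition pd :: "nat \<Rightarrow> nat \<Rightarrow> qpoly \<Rightarrow> qpoly"
  where "pd n k = divdiff n (qact n k) k"

definition xpd :: "nat \<Rightarrow> nat \<Rightarrow> qpoly \<Rightarrow> qpoly"
  where "xpd n k = divdiff n (xact k) k"

definition qpd1 :: "nat \<Rightarrow> qpoly \<Rightarrow> qpoly"
  where "qpd1 n = pd n 1"

definition qpd2 :: "nat \<Rightarrow> qpoly \<Rightarrow> qpoly"
  where "qpd2 n = pd n 2 \<circ> (\<lambda>F. F - qq n 1 2 * (pd n 1 \<circ> pd n 2) F)"

definition qpd :: "nat \<Rightarrow> nat \<Rightarrow> qpoly \<Rightarrow> qpoly"
  where "qpd n k = (if k = 1 then qpd1 n else qpd2 n)"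


section \<open>Schubert polynomials and their quantization\<close>

text \<open>Elements of \<open>S\<^sub>n\<close> are functions on the naturals that permute \<open>{1..n}\<close>.\<close>

definition longest_perm :: "nat \<Rightarrow> nat \<Rightarrow> nat"
  where "longest_perm n i = (if i \<in> {1..n} then n + 1 - i else i)"

text \<open>The graph of \<open>w \<mapsto> \<SS>\<^sub>w\<close>, generated by the two defining rules.\<close>

inductive is_schubert :: "nat \<Rightarrow> (nat \<Rightarrow> nat) \<Rightarrow> qpoly \<Rightarrow> bool" for n
  where
    top: "is_schubert n (longest_perm n) (\<Prod>i = 1..n. xx i ^ (n - i))"
  | step: "is_schubert n (w \<circ> adj_transp k) (xpd n k F)"
      if "is_schubert n w F" "w permutes {1..n}" "1 \<le> k" "k < n" "w k > w (k + 1)"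

definition schubert :: "nat \<Rightarrow> (nat \<Rightarrow> nat) \<Rightarrow> qpoly"
  where "schubert n w = (THE F. is_schubert n w F)"

definition elem_indices :: "nat \<Rightarrow> (nat \<Rightarrow> nat) set"
  where "elem_indices n = (\<Pi>\<^sub>E p \<in> {1..n-1}. {0..p})"

definition schubert_coeff :: "nat \<Rightarrow> (nat \<Rightarrow> nat) \<Rightarrow> (nat \<Rightarrow> nat) \<Rightarrow> int"
  where "schubert_coeff n w = (THE c.
           (\<forall>I. I \<notin> elem_indices n \<longrightarrow> c I = 0) \<and>
           schubert n w = (\<Sum>I \<in> elem_indices n. of_int (c I) * (\<Prod>p = 1..n-1. elem p (I p))))"

definition qschubert :: "nat \<Rightarrow> (nat \<Rightarrow> nat) \<Rightarrow> qpoly"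
  where "qschubert n w =
           (\<Sum>I \<in> elem_indices n.
              of_int (schubert_coeff n w I) * (\<Prod>p = 1..n-1. qelem n p (I p)))"

end

theory Submission
  imports Defs "Jordan_Normal_Form.Column_Operations"
begin

text \<open>
  The matrix \<open>s\<^sub>k M\<^sub>j\<close> is conjugate to \<open>M\<^sub>j\<close> by an elementary matrix when \<open>j > k\<close>, so every
  \<open>E\<^sub>i\<close> of level \<open>j \<noteq> k\<close> is \<open>s\<^sub>k\<close>-invariant, just as \<open>e\<^sub>i\<close> of level \<open>j \<noteq> k\<close> is classically.
  Hence for \<open>k \<le> 2\<close> the operator only sees the factors of level 1 and 2 of an elementary monomial,
  and comparing the finitely many cases shows that quantization intertwines \<open>\<partial>\<^sub>k\<close> with its quantum
  version on the span of the elementary monomials. This gives the claim because \<open>\<partial>\<^sub>k \<SS>\<^sub>w\<close> is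
  \<open>\<SS>\<close> of \<open>w s\<^sub>k\<close> or 0.

  For quantization to be defined, \<open>\<SS>\<^sub>w\<close> has to be independent of the chosen descents (local
  confluence from the commutation and braid relations), the span of the elementary monomials has to
  be closed under every \<open>\<partial>\<^sub>k\<close> (straightening), and these monomials have to be linearly independent;
  the latter is proved with coefficients that are symmetric polynomials, so that divided differences
  can be applied to a relation.
\<close>

section \<open>Substitution and the subring \<open>R\<^sub>n\<close>\<close>

text \<open>A polynomial over the integers is also an element of the free abelian group on its
  monomials. Identifying the two scalar multiplications makes \<open>frag_extend\<close> and
  \<open>frag_induction\<close> available for \<open>qpoly\<close>.\<close>

lemma of_int_mult_eq_frag_cmul: "of_int c * F = frag_cmul c (F :: qpoly)"
proof (rule poly_mapping_eqI)
  fix m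
  have "of_int c * F = Poly_Mapping.map ((*) c) F"
    using single_of_int[of c, where 'a = "qvar \<Rightarrow>\<^sub>0 nat" and 'b = int]
    by (simp add: mult_map_scale_conv_mult)
  then show "Poly_Mapping.lookup (of_int c * F) m = Poly_Mapping.lookup (frag_cmul c F) m"
    by (simp add: Poly_Mapping.map.rep_eq when_def)
qed

definition monomial_value :: "(qvar \<Rightarrow> qpoly) \<Rightarrow> (qvar \<Rightarrow>\<^sub>0 nat) \<Rightarrow> qpoly"
  where "monomial_value f m = (\<Prod>v \<in> Poly_Mapping.keys m. f v ^ Poly_Mapping.lookup m v)"

lemma subst_eq_frag_extend: "subst f = frag_extend (monomial_value f)"
  by (intro ext) (simp add: subst_def frag_extend_def monomial_value_def of_int_mult_eq_frag_cmul)

lemma monomial_value_superset: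
  assumes "finite V" "Poly_Mapping.keys m \<subseteq> V"
  shows "monomial_value f m = (\<Prod>v \<in> V. f v ^ Poly_Mapping.lookup m v)"
  unfolding monomial_value_def
  using assms by (intro prod.mono_neutral_left) (auto simp: in_keys_iff)

lemma monomial_value_0 [simp]: "monomial_value f 0 = 1"
  by (simp add: monomial_value_def)

lemma monomial_value_add: "monomial_value f (m + m') = monomial_value f m * monomial_value f m'"
proof -
  let ?V = "Poly_Mapping.keys m \<union> Poly_Mapping.keys m'"
  have "monomial_value f (m + m') = (\<Prod>v \<in> ?V. f v ^ Poly_Mapping.lookup (m + m') v)"
    by (rule monomial_value_superset) (simp_all add: keys_add)
  also have "\<dots> = (\<Prod>v \<in> ?V. f v ^ Poly_Mapping.lookup m v)
                * (\<Prod>v \<in> ?V. f v ^ Poly_Mapping.lookup m' v)"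
    by (simp add: lookup_add power_add prod.distrib)
  also have "\<dots> = monomial_value f m * monomial_value f m'"
    by (simp add: monomial_value_superset[of ?V])
  finally show ?thesis .
qed

lemma subst_add: "subst f (F + G) = subst f F + subst f G"
  by (simp add: subst_eq_frag_extend frag_extend_add)

lemma subst_diff: "subst f (F - G) = subst f F - subst f G"
  by (simp add: subst_eq_frag_extend frag_extend_diff)

lemma subst_frag_of: "subst f (frag_of m) = monomial_value f m"
  by (simp add: subst_eq_frag_extend)

lemma subst_0 [simp]: "subst f 0 = 0"
  by (simp add: subst_eq_frag_extend)

text \<open>Both sides are biadditive, so two inductions reduce the claim to monomials, where
  exponents add.\<close>

lemma subst_mult: "subst f (F * G) = subst f F * subst f G"
proof (induction F rule: frag_induction[OF subset_UNIV])
  case (2 m)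
  show ?case
  proof (induction G rule: frag_induction[OF subset_UNIV])
    case (2 m')
    show ?case by (simp add: mult_single subst_frag_of monomial_value_add)
  qed (simp_all add: subst_diff right_diff_distrib)
qed (simp_all add: subst_diff left_diff_distrib)

lemma subst_1: "subst f 1 = 1"
  using subst_frag_of[of f 0] by simp

interpretation subst: comm_ring_hom "subst f" for f
  by unfold_locales (simp_all add: subst_add subst_mult subst_1)

lemma subst_var [simp]: "subst f (var v) = f v"
  by (simp add: var_def subst_frag_of[simplified] monomial_value_def)

lemma single_eq_var_power: "Poly_Mapping.single (Poly_Mapping.single v k) 1 = var v ^ k"
proof (induction k)
  case (Suc k)
  have "Poly_Mapping.single v (Suc k) = Poly_Mapping.single v 1 + Poly_Mapping.single v k"
    by (simp flip: single_add)
  then have "Poly_Mapping.single (Poly_Mapping.single v (Suc k)) 1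
      = var v * Poly_Mapping.single (Poly_Mapping.single v k) 1"
    by (simp only: var_def mult_single mult_1)
  with Suc show ?case by simp
qed simp

lemma frag_of_eq_monomial_value: "frag_of m = monomial_value var m"
proof -
  have sum: "m = (\<Sum>v \<in> Poly_Mapping.keys m. Poly_Mapping.single v (Poly_Mapping.lookup m v))"
    by (rule poly_mapping_eqI) (simp add: lookup_sum lookup_single when_def in_keys_iff)
  have "frag_of (\<Sum>v \<in> V. Poly_Mapping.single v (Poly_Mapping.lookup m v))
      = (\<Prod>v \<in> V. var v ^ Poly_Mapping.lookup m v)" if "finite V" for V
    using that
  proof induction
    case (insert v V)
    have "frag_of (a + b) = frag_of a * frag_of b" for a b :: "qvar \<Rightarrow>\<^sub>0 nat"
      by (simp add: mult_single)
    with insert show ?case by (simp add: single_eq_var_power[simplified])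
  qed simp
  then show ?thesis
    unfolding monomial_value_def by (subst (1) sum) simp
qed

text \<open>Universal property of the polynomial ring. It turns composites of actions into single
  substitutions, which can then be compared variable by variable.\<close>

lemma comm_ring_hom_eq_subst:
  assumes "comm_ring_hom h"
  shows "h F = subst (\<lambda>v. h (var v)) F"
proof -
  interpret h: comm_ring_hom h by fact
  show ?thesis
  proof (induction F rule: frag_induction[OF subset_UNIV])
    case (2 m)
    show ?case
      by (simp add: frag_of_eq_monomial_value monomial_value_def h.hom_prod h.hom_power
          subst.hom_prod subst.hom_power)
  qed (simp_all add: h.hom_minus subst_diff)
qed

lemma subst_subst: "subst f (subst g F) = subst (\<lambda>v. subst f (g v)) F"
proof -
  have "comm_ring_hom (\<lambda>F. subst f (subst g F))"
    by unfold_locales (simp_all add: subst_add subst_mult)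
  from comm_ring_hom_eq_subst[OF this] show ?thesis by simp
qed

text \<open>Setting \<open>X i\<close> to 0 and every other variable to 1 separates the variables.
  Hence x_k - x_(k+1) is nonzero and can be cancelled.\<close>

lemma xx_eq_iff [simp]: "xx i = xx j \<longleftrightarrow> i = j"
proof
  assume "xx i = xx j"
  then have "subst (\<lambda>v. if v = X i then 0 else 1) (xx i) = subst (\<lambda>v. if v = X i then 0 else 1) (xx j)"
    by simp
  then show "i = j" by (simp add: xx_def split: if_splits)
qed simp

section \<open>Closure properties of the subring\<close>

lemma qring_0 [simp]: "0 \<in> qring n"
  and qring_1 [simp]: "1 \<in> qring n"
  by (simp_all add: qring_def)

lemma qring_of_int [simp]: "of_int c \<in> qring n"
  by (auto simp: qring_def lookup_of_int in_keys_iff)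

lemma qring_add: "F \<in> qring n \<Longrightarrow> G \<in> qring n \<Longrightarrow> F + G \<in> qring n"
  unfolding qring_def using keys_add[of F G] by blast

lemma qring_uminus: "F \<in> qring n \<Longrightarrow> - F \<in> qring n"
  by (simp add: qring_def)

lemma qring_diff: "F \<in> qring n \<Longrightarrow> G \<in> qring n \<Longrightarrow> F - G \<in> qring n"
  unfolding qring_def using keys_diff[of F G] by blast

lemma qring_mult: "F \<in> qring n \<Longrightarrow> G \<in> qring n \<Longrightarrow> F * G \<in> qring n"
proof -
  assume F: "F \<in> qring n" and G: "G \<in> qring n"
  have "Poly_Mapping.keys m \<subseteq> qvars n" if "m \<in> Poly_Mapping.keys (F * G)" for m
  proof -
    from that obtain a b where "m = a + b" "a \<in> Poly_Mapping.keys F" "b \<in> Poly_Mapping.keys G"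
      using keys_mult[of F G] by blast
    with F G show ?thesis
      using keys_add[of a b] unfolding qring_def by blast
  qed
  then show ?thesis
    by (simp add: qring_def)
qed

lemma qring_sum: "(\<And>i. i \<in> I \<Longrightarrow> F i \<in> qring n) \<Longrightarrow> (\<Sum>i \<in> I. F i) \<in> qring n"
  by (induction I rule: infinite_finite_induct) (auto intro: qring_add)

lemma qring_prod: "(\<And>i. i \<in> I \<Longrightarrow> F i \<in> qring n) \<Longrightarrow> (\<Prod>i \<in> I. F i) \<in> qring n"
  by (induction I rule: infinite_finite_induct) (auto intro: qring_mult)

lemma var_in_qring: "v \<in> qvars n \<Longrightarrow> var v \<in> qring n"
  by (simp add: qring_def var_def)

lemma xx_in_qring: "1 \<le> i \<Longrightarrow> i \<le> n \<Longrightarrow> xx i \<in> qring n"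
  by (auto simp: xx_def qvars_def intro!: var_in_qring)

lemma qq_in_qring: "qq n i j \<in> qring n"
  by (auto simp: qq_def qvars_def intro!: var_in_qring)

lemmas qring_intros = qring_0 qring_1 qring_of_int qring_add qring_uminus qring_diff qring_mult
  qring_sum qring_prod xx_in_qring qq_in_qring

section \<open>Divided differences as a relation\<close>

text \<open>A relation in place of the \<open>THE\<close> in \<open>divdiff\<close>: exhibiting a
  quotient settles existence and value at once, and the rules below propagate both.\<close>

definition is_divdiff :: "nat \<Rightarrow> (qpoly \<Rightarrow> qpoly) \<Rightarrow> nat \<Rightarrow> qpoly \<Rightarrow> qpoly \<Rightarrow> bool"
  where "is_divdiff n s k F G \<longleftrightarrow> G \<in> qring n \<and> (xx k - xx (k + 1)) * G = F - s F"

lemma xx_diff_mult_cancel: "i \<noteq> j \<Longrightarrow> (xx i - xx j) * F = (xx i - xx j) * G \<longleftrightarrow> F = G"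
  by simp

lemma is_divdiff_unique: "is_divdiff n s k F G \<Longrightarrow> is_divdiff n s k F G' \<Longrightarrow> G = G'"
  unfolding is_divdiff_def by (metis xx_diff_mult_cancel Suc_eq_plus1 n_not_Suc_n)

lemma divdiff_eqI: "is_divdiff n s k F G \<Longrightarrow> divdiff n s k F = G"
  unfolding divdiff_def
  by (rule the_equality) (auto simp: is_divdiff_def intro: is_divdiff_unique)

context
  fixes s :: "qpoly \<Rightarrow> qpoly"
  assumes s: "comm_ring_hom s"
begin

interpretation s: comm_ring_hom s by (rule s)

lemma is_divdiff_zero: "is_divdiff n s k 0 0"
  by (simp add: is_divdiff_def)

lemma is_divdiff_add:
  "is_divdiff n s k F G \<Longrightarrow> is_divdiff n s k F' G' \<Longrightarrow> is_divdiff n s k (F + F') (G + G')"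
  by (simp add: is_divdiff_def qring_add s.hom_add distrib_left)

text \<open>Invariant factors behave like scalars, so only the factors that move have to be
  computed.\<close>

lemma is_divdiff_mult:
  "s P = P \<Longrightarrow> P \<in> qring n \<Longrightarrow> is_divdiff n s k F G \<Longrightarrow> is_divdiff n s k (P * F) (P * G)"
  unfolding is_divdiff_def
  by (metis qring_mult s.hom_mult mult.left_commute right_diff_distrib)

lemma is_divdiff_sum:
  "(\<And>i. i \<in> I \<Longrightarrow> is_divdiff n s k (F i) (G i)) \<Longrightarrow>
    is_divdiff n s k (\<Sum>i \<in> I. F i) (\<Sum>i \<in> I. G i)"
  by (induction I rule: infinite_finite_induct) (auto intro: is_divdiff_zero is_divdiff_add)

lemma is_divdiff_of_int_mult:
  "is_divdiff n s k F G \<Longrightarrow> is_divdiff n s k (of_int c * F) (of_int c * G)"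
  by (rule is_divdiff_mult) (simp_all add: s.hom_of_int)

lemma is_divdiff_invariant: "s P = P \<Longrightarrow> is_divdiff n s k P 0"
  by (simp add: is_divdiff_def)

text \<open>The action negates both F - s F and x_k - x_(k+1), hence fixes their quotient.\<close>

lemma invariant_divdiff:
  assumes "s (xx k) = xx (k + 1)" "s (xx (k + 1)) = xx k" "s (s F) = F" "is_divdiff n s k F G"
  shows "s G = G"
proof -
  have "s ((xx k - xx (k + 1)) * G) = s (F - s F)"
    using assms(4) by (simp add: is_divdiff_def)
  then have "(xx k - xx (k + 1)) * s G = F - s F"
    using assms(1-3) by (simp add: s.hom_mult s.hom_minus algebra_simps)
  with assms(4) show ?thesis
    by (metis is_divdiff_def xx_diff_mult_cancel Suc_eq_plus1 n_not_Suc_n)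
qed

end

section \<open>Elementary symmetric polynomials\<close>

lemma elem_0 [simp]: "elem j 0 = 1"
proof -
  have "{A. A \<subseteq> {1..j} \<and> card A = 0} = {{}}"
    by (auto simp: card_eq_0_iff dest: finite_subset)
  then show ?thesis by (simp add: elem_def)
qed

lemma elem_eq_0: "j < i \<Longrightarrow> elem j i = 0"
proof -
  assume "j < i"
  then have "{A. A \<subseteq> {1..j} \<and> card A = i} = {}"
  proof (intro equals0I)
    fix A assume "A \<in> {A. A \<subseteq> {1..j} \<and> card A = i}"
    with \<open>j < i\<close> show False
      using card_mono[of "{1..j}" A] by simp
  qed
  then show ?thesis unfolding elem_def by (simp only: sum.empty)
qed

text \<open>Subsets of \<open>{1..Suc j}\<close> are split according to whether they contain
  \<open>Suc j\<close>.\<close>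

lemma elem_Suc_Suc: "elem (Suc j) (Suc i) = elem j (Suc i) + xx (Suc j) * elem j i"
proof -
  let ?S = "\<lambda>(j :: nat) i. {A. A \<subseteq> {1..j} \<and> card A = i}"
  have fin: "finite (?S j i)" for j i
    by simp
  have notin: "Suc j \<notin> A" "finite A" if "A \<subseteq> {1..j}" for A
    using that finite_subset[OF that] by auto
  have split: "?S (Suc j) (Suc i) = ?S j (Suc i) \<union> insert (Suc j) ` ?S j i"
  proof (intro equalityI subsetI)
    fix A assume A: "A \<in> ?S (Suc j) (Suc i)"
    show "A \<in> ?S j (Suc i) \<union> insert (Suc j) ` ?S j i"
    proof (cases "Suc j \<in> A")
      case True
      with A have "A - {Suc j} \<in> ?S j i" "A = insert (Suc j) (A - {Suc j})"
        by (auto simp: le_Suc_eq)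
      then show ?thesis by blast
    next
      case False
      with A show ?thesis by (auto simp: le_Suc_eq)
    qed
  next
    fix A assume "A \<in> ?S j (Suc i) \<union> insert (Suc j) ` ?S j i"
    then show "A \<in> ?S (Suc j) (Suc i)"
    proof
      assume "A \<in> insert (Suc j) ` ?S j i"
      then obtain B where "A = insert (Suc j) B" "B \<subseteq> {1..j}" "card B = i"
        by auto
      then show ?thesis
        using notin[of B] by auto
    qed auto
  qed
  have "elem (Suc j) (Suc i)
      = (\<Sum>A \<in> ?S j (Suc i). \<Prod>a \<in> A. xx a) + (\<Sum>A \<in> insert (Suc j) ` ?S j i. \<Prod>a \<in> A. xx a)"
    unfolding elem_def split using fin notin by (intro sum.union_disjoint) auto
  also have "(\<Sum>A \<in> insert (Suc j) ` ?S j i. \<Prod>a \<in> A. xx a)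
      = (\<Sum>A \<in> ?S j i. \<Prod>a \<in> insert (Suc j) A. xx a)"
    using notin by (intro sum.reindex_cong[OF _ refl refl]) (auto simp: inj_on_def insert_ident)
  also have "\<dots> = xx (Suc j) * elem j i"
    unfolding elem_def sum_distrib_left by (intro sum.cong refl) (auto simp: notin)
  finally show ?thesis by (simp add: elem_def)
qed

lemma elem_0_left: "elem 0 i = (if i = 0 then 1 else 0)"
  by (simp add: elem_eq_0)

lemma elem_self: "elem j j = (\<Prod>i = 1..j. xx i)"
  by (induction j) (simp_all add: elem_Suc_Suc elem_eq_0 mult.commute)

lemma elem_in_qring: "j \<le> n \<Longrightarrow> elem j i \<in> qring n"
  unfolding elem_def by (auto intro!: qring_sum qring_prod xx_in_qring)

text \<open>On the right only the first product has both factors of level \<open>j\<close>, and its first index is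
  smaller: iterating the rule eliminates repeated levels.\<close>

lemma elem_straighten:
  "elem j (Suc a) * elem j b
    = elem j a * elem j (Suc b) - elem j a * elem (Suc j) (Suc b) + elem j b * elem (Suc j) (Suc a)"
  by (simp add: elem_Suc_Suc algebra_simps)

section \<open>The classical action of adjacent transpositions\<close>

interpretation xact: comm_ring_hom "xact k" for k
  unfolding xact_def by (rule subst.comm_ring_hom_axioms)

lemma xact_xx [simp]: "xact k (xx i) = xx (adj_transp k i)"
  by (simp add: xact_def xx_def)

lemma xact_xact: "xact k (xact l F) = subst (\<lambda>v. xact k (xact_var l v)) F"
  by (simp add: xact_def subst_subst)

lemma xact_involution [simp]: "xact k (xact k F) = F"
proof -
  have "(\<lambda>v. xact k (xact_var k v)) = var"
  proof
    fix v show "xact k (xact_var k v) = var v"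
      by (cases v) (simp_all add: xx_def xact_def)
  qed
  moreover have "comm_ring_hom (\<lambda>F :: qpoly. F)"
    by unfold_locales auto
  from comm_ring_hom_eq_subst[OF this, of F] have "subst var F = F"
    by (rule sym)
  ultimately show ?thesis by (simp add: xact_xact)
qed

lemma xact_commute:
  assumes "k + 1 < l"
  shows "xact k (xact l F) = xact l (xact k F)"
proof -
  have "(\<lambda>v. xact k (xact_var l v)) = (\<lambda>v. xact l (xact_var k v))"
  proof
    fix v show "xact k (xact_var l v) = xact l (xact_var k v)"
      using assms by (cases v) (auto simp: xact_def transpose_def xx_def)
  qed
  then show ?thesis by (simp add: xact_xact)
qed

lemma xact_braid: "xact k (xact (k + 1) (xact k F)) = xact (k + 1) (xact k (xact (k + 1) F))"
proof -
  have "xact k (xact (k + 1) (xact_var k v)) = xact (k + 1) (xact k (xact_var (k + 1) v))" for v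
    by (cases v) (auto simp: xact_def transpose_def xx_def)
  then show ?thesis by (simp add: xact_def subst_subst)
qed

lemma xact_elem_less: "j < k \<Longrightarrow> xact k (elem j i) = elem j i"
  unfolding elem_def
  by (auto simp: xact.hom_sum xact.hom_prod transpose_def intro!: sum.cong prod.cong)

text \<open>Expanding two levels down to k - 1 leaves coefficients symmetric in x_k and x_(k+1), and
  level k - 1 involves neither variable.\<close>

lemma xact_elem_Suc:
  assumes "1 \<le> k"
  shows "xact k (elem (k + 1) i) = elem (k + 1) i"
proof -
  obtain j where j: "k = Suc j" using assms by (cases k) auto
  have inv: "xact k (elem j i) = elem j i" for i by (simp add: j xact_elem_less)
  show ?thesis
  proof (cases i)
    case (Suc i)
    have "elem (k + 1) (Suc i) =
      elem j (Suc i) + (xx k + xx (k + 1)) * elem j i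
        + (if i = 0 then 0 else xx k * xx (k + 1) * elem j (i - 1))"
      by (cases i) (simp_all add: j elem_Suc_Suc algebra_simps)
    with Suc show ?thesis
      by (simp add: xact.hom_add xact.hom_mult inv)
  qed simp
qed

lemma xact_elem:
  assumes "1 \<le> k" "j \<noteq> k"
  shows "xact k (elem j i) = elem j i"
proof (cases "j < k")
  case False
  then have "k + 1 \<le> j" using assms by simp
  then show ?thesis
  proof (induction j arbitrary: i rule: dec_induct)
    case base
    show ?case by (rule xact_elem_Suc[OF assms(1)])
  next
    case (step j)
    then have "adj_transp k (Suc j) = Suc j" by (simp add: transpose_def)
    with step show ?case
      by (cases i) (simp_all add: elem_Suc_Suc xact.hom_add xact.hom_mult)
  qed
qed (rule xact_elem_less)

text \<open>In e_(i+1)^(k) = e_(i+1)^(k-1) + x_k e_i^(k-1) only x_k moves, and its divided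
  difference is 1.\<close>

lemma is_divdiff_elem:
  assumes "1 \<le> k" "k < n"
  shows "is_divdiff n (xact k) k (elem k (Suc i)) (elem (k - 1) i)"
proof -
  obtain j where j: "k = Suc j" using assms by (cases k) auto
  have "xact (Suc j) (elem j i) = elem j i" for i by (simp add: xact_elem_less)
  then show ?thesis
    using assms by (simp add: is_divdiff_def elem_in_qring elem_Suc_Suc xact.hom_add xact.hom_mult j
      left_diff_distrib)
qed

section \<open>Linear independence of the elementary monomials\<close>

lemma xact_elem_same: "xact (Suc m) (elem (Suc m) (Suc i))
    = elem (Suc m) (Suc i) - (xx (Suc m) - xx (Suc (Suc m))) * elem m i"
  by (simp add: elem_Suc_Suc xact.hom_add xact.hom_mult xact_elem_less algebra_simps)

text \<open>In the induction step, \<open>\<partial>\<close> turns a relation of level \<open>m + 1\<close> into one of level \<open>m\<close>.\<close>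

lemma elem_level_independent:
  assumes "\<And>k i. 1 \<le> k \<Longrightarrow> k \<le> m \<Longrightarrow> xact k (\<mu> i) = \<mu> i"
    and "(\<Sum>i\<le>m. \<mu> i * elem m i) = 0" and "i \<le> m"
  shows "\<mu> i = 0"
  using assms
proof (induction m arbitrary: \<mu> i)
  case (Suc m)
  have shift: "(\<Sum>i\<le>Suc m. \<mu> i * elem (Suc m) i) = \<mu> 0 + (\<Sum>i\<le>m. \<mu> (Suc i) * elem (Suc m) (Suc i))"
    by (simp only: sum.atMost_Suc_shift elem_0 mult_1_right)
  have inv: "xact (Suc m) (\<mu> i) = \<mu> i" for i
    using Suc.prems(1)[of "Suc m"] by simp
  have "xact (Suc m) (\<Sum>i\<le>Suc m. \<mu> i * elem (Suc m) i)
      = \<mu> 0 + (\<Sum>i\<le>m. \<mu> (Suc i) * (elem (Suc m) (Suc i) - (xx (Suc m) - xx (Suc (Suc m))) * elem m i))"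
    unfolding shift by (simp only: xact.hom_add xact.hom_sum xact.hom_mult inv xact_elem_same)
  also have "\<dots> = (\<Sum>i\<le>Suc m. \<mu> i * elem (Suc m) i)
      - (xx (Suc m) - xx (Suc (Suc m))) * (\<Sum>i\<le>m. \<mu> (Suc i) * elem m i)"
    unfolding shift
    by (simp add: right_diff_distrib sum_subtractf sum_distrib_left mult.left_commute)
  finally have "(\<Sum>i\<le>m. \<mu> (Suc i) * elem m i) = 0"
    unfolding Suc.prems(2) by simp
  then have pos: "\<mu> (Suc i) = 0" if "i \<le> m" for i
    using Suc.IH[of "\<lambda>i. \<mu> (Suc i)" i] Suc.prems(1) that by simp
  with Suc.prems(2) have "\<mu> 0 = 0"
    unfolding shift by simp
  with pos Suc.prems(3) show ?case
    by (cases i) simp_all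
qed simp

text \<open>The top level is peeled off: grouping by the remaining indices gives coefficients
  \<open>d J\<close>, which are again invariant because level m + 1 is fixed by s_1, ..., s_m. The
  induction makes them vanish, and the one-level lemma then applies to each.\<close>

lemma elem_products_independent:
  assumes "\<And>k I. 1 \<le> k \<Longrightarrow> k \<le> m \<Longrightarrow> xact k (c I) = c I"
    and "(\<Sum>I \<in> (\<Pi>\<^sub>E p \<in> {1..m}. {0..p}). c I * (\<Prod>p = 1..m. elem p (I p))) = 0"
    and "I \<in> (\<Pi>\<^sub>E p \<in> {1..m}. {0..p})"
  shows "c I = 0"
  using assms
proof (induction m arbitrary: c I)
  case (Suc m)
  let ?P = "\<lambda>m. \<Pi>\<^sub>E p \<in> {1..m}. {0..p}"
  define d where "d J = (\<Sum>i\<le>Suc m. c (J(Suc m := i)) * elem (Suc m) i)" for J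
  have interval: "{1..Suc m} = insert (Suc m) {1..m}"
    by auto
  have P: "?P (Suc m) = (\<lambda>(i, J). J(Suc m := i)) ` ({0..Suc m} \<times> ?P m)"
    unfolding interval by (rule PiE_insert_eq)
  have inj: "inj_on (\<lambda>(i, J). J(Suc m := i)) ({0..Suc m} \<times> ?P m)"
    by (rule inj_combinator) simp
  have "(\<Sum>I \<in> ?P (Suc m). c I * (\<Prod>p = 1..Suc m. elem p (I p)))
      = (\<Sum>(i, J) \<in> {0..Suc m} \<times> ?P m.
          c (J(Suc m := i)) * (\<Prod>p = 1..Suc m. elem p ((J(Suc m := i)) p)))"
    unfolding P sum.reindex[OF inj] by (intro sum.cong) auto
  also have "\<dots> = (\<Sum>(i, J) \<in> {0..Suc m} \<times> ?P m.
          c (J(Suc m := i)) * elem (Suc m) i * (\<Prod>p = 1..m. elem p (J p)))"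
    by (intro sum.cong) (auto simp: mult_ac)
  also have "\<dots> = (\<Sum>J \<in> ?P m. d J * (\<Prod>p = 1..m. elem p (J p)))"
    unfolding d_def sum_distrib_right atMost_atLeast0 sum.cartesian_product[symmetric]
    by (rule sum.swap)
  finally have "(\<Sum>J \<in> ?P m. d J * (\<Prod>p = 1..m. elem p (J p))) = 0"
    using Suc.prems(2) by simp
  moreover have "xact k (d J) = d J" if "1 \<le> k" "k \<le> m" for k J
    using that unfolding d_def
    by (simp add: xact.hom_sum xact.hom_mult xact.hom_add Suc.prems(1) xact_elem
        del: sum.atMost_Suc fun_upd_apply)
  ultimately have d: "d J = 0" if "J \<in> ?P m" for J
    using Suc.IH that by blast
  from Suc.prems(3) obtain i J where IJ: "i \<le> Suc m" "J \<in> ?P m" "I = J(Suc m := i)"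
    unfolding P by auto
  have "c (J(Suc m := i)) = 0"
    by (rule elem_level_independent[where \<mu> = "\<lambda>i. c (J(Suc m := i))", OF _ d[OF IJ(2), unfolded d_def] IJ(1)])
      (rule Suc.prems(1), simp_all)
  with IJ show ?case by blast
qed simp

section \<open>Quantization as a relation\<close>

abbreviation elem_product :: "(nat \<Rightarrow> nat \<Rightarrow> qpoly) \<Rightarrow> nat \<Rightarrow> (nat \<Rightarrow> nat) \<Rightarrow> qpoly"
  where "elem_product g n I \<equiv> (\<Prod>p = 1..n-1. g p (I p))"

text \<open>Quantization as a relation is linear by construction; single-valuedness can be supplied
  later by linear independence.\<close>

definition quantizes :: "nat \<Rightarrow> qpoly \<Rightarrow> qpoly \<Rightarrow> bool"
  where "quantizes n F G \<longleftrightarrow> (\<exists>c.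
    F = (\<Sum>I \<in> elem_indices n. of_int (c I) * elem_product elem n I) \<and>
    G = (\<Sum>I \<in> elem_indices n. of_int (c I) * elem_product (qelem n) n I))"

lemma finite_elem_indices: "finite (elem_indices n)"
  by (auto simp: elem_indices_def intro: finite_PiE)

lemma quantizes_0: "quantizes n 0 0"
  unfolding quantizes_def by (rule exI[of _ "\<lambda>_. 0"]) simp

lemma quantizes_add: "quantizes n F G \<Longrightarrow> quantizes n F' G' \<Longrightarrow> quantizes n (F + F') (G + G')"
proof -
  assume "quantizes n F G" "quantizes n F' G'"
  then obtain c c' where
    "F = (\<Sum>I \<in> elem_indices n. of_int (c I) * elem_product elem n I)"
    "G = (\<Sum>I \<in> elem_indices n. of_int (c I) * elem_product (qelem n) n I)"
    "F' = (\<Sum>I \<in> elem_indices n. of_int (c' I) * elem_product elem n I)"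
    "G' = (\<Sum>I \<in> elem_indices n. of_int (c' I) * elem_product (qelem n) n I)"
    unfolding quantizes_def by blast
  then show ?thesis
    unfolding quantizes_def
    by (intro exI[of _ "\<lambda>I. c I + c' I"]) (simp add: distrib_right sum.distrib)
qed

lemma quantizes_scale: "quantizes n F G \<Longrightarrow> quantizes n (of_int a * F) (of_int a * G)"
proof -
  assume "quantizes n F G"
  then obtain c where
    "F = (\<Sum>I \<in> elem_indices n. of_int (c I) * elem_product elem n I)"
    "G = (\<Sum>I \<in> elem_indices n. of_int (c I) * elem_product (qelem n) n I)"
    unfolding quantizes_def by blast
  then show ?thesis
    unfolding quantizes_def
    by (intro exI[of _ "\<lambda>I. a * c I"]) (simp add: sum_distrib_left mult.assoc)
qed

lemma quantizes_diff: "quantizes n F G \<Longrightarrow> quantizes n F' G' \<Longrightarrow> quantizes n (F - F') (G - G')"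
  using quantizes_add[OF _ quantizes_scale[of n F' G' "-1"]] by simp

lemma quantizes_sum:
  "(\<And>i. i \<in> A \<Longrightarrow> quantizes n (F i) (G i)) \<Longrightarrow> quantizes n (\<Sum>i \<in> A. F i) (\<Sum>i \<in> A. G i)"
  by (induction A rule: infinite_finite_induct) (auto intro: quantizes_0 quantizes_add)

lemma quantizes_elem_product:
  "quantizes n (elem_product elem n J) (elem_product (qelem n) n J)"
proof (cases "\<forall>p \<in> {1..n-1}. J p \<le> p")
  case True
  \<comment> \<open>Members of \<open>elem_indices n\<close> are \<open>undefined\<close> outside
    \<open>{1..n-1}\<close>; the products do not see the restriction.\<close>
  let ?I = "restrict J {1..n-1}"
  have I: "?I \<in> elem_indices n"
    using True by (auto simp: elem_indices_def)
  have delta: "(\<Sum>I \<in> elem_indices n. of_int (if I = ?I then 1 else 0) * f I) = f ?I" for f :: "_ \<Rightarrow> qpoly"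
  proof -
    have "(\<Sum>I \<in> elem_indices n. of_int (if I = ?I then 1 else 0) * f I)
        = (\<Sum>I \<in> elem_indices n. if I = ?I then f I else 0)"
      by (intro sum.cong) auto
    then show ?thesis
      using finite_elem_indices I by simp
  qed
  show ?thesis
    unfolding quantizes_def
    by (rule exI[of _ "\<lambda>I. if I = ?I then 1 else 0"]) (simp only: delta, simp)
next
  case False
  then obtain p where "p \<in> {1..n-1}" "p < J p"
    by (auto simp: not_le)
  then have "elem_product elem n J = 0" "elem_product (qelem n) n J = 0"
    by (auto simp: elem_eq_0 qelem_def intro!: prod_zero bexI[of _ p])
  then show ?thesis
    by (simp only: quantizes_0)
qed

text \<open>Integers are fixed by every action, so the independence over invariant coefficients
  applies to the difference.\<close>

lemma elem_product_coeff_unique: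
  assumes "(\<Sum>I \<in> elem_indices n. of_int (c I) * elem_product elem n I)
      = (\<Sum>I \<in> elem_indices n. of_int (c' I) * elem_product elem n I)"
    and "I \<in> elem_indices n"
  shows "c I = c' I"
proof -
  have "(\<Sum>I \<in> elem_indices n. of_int (c I - c' I) * elem_product elem n I) = 0"
    using assms(1) by (simp add: left_diff_distrib sum_subtractf)
  then have "of_int (c I - c' I) = (0 :: qpoly)"
    using assms(2) unfolding elem_indices_def
    by (intro elem_products_independent[where c = "\<lambda>I. of_int (c I - c' I)"])
      (simp_all only: xact.hom_of_int)
  then show ?thesis
    by (simp only: of_int_eq_0_iff right_minus_eq)
qed

lemma quantizes_schubert_unique:
  assumes "quantizes n (schubert n w) G"
  shows "G = qschubert n w"
proof -
  let ?expand = "\<lambda>g c. \<Sum>I \<in> elem_indices n. of_int (c I) * elem_product g n I"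
  obtain c where c: "schubert n w = ?expand elem c" "G = ?expand (qelem n) c"
    using assms unfolding quantizes_def by blast
  \<comment> \<open>\<open>schubert_coeff\<close> demands zero coefficients outside the index set,
    whereas \<open>quantizes\<close> leaves them open.\<close>
  define c' where "c' = (\<lambda>I. if I \<in> elem_indices n then c I else 0)"
  have c': "?expand g c' = ?expand g c" for g
    by (intro sum.cong) (auto simp: c'_def)
  have "schubert_coeff n w = c'"
    unfolding schubert_coeff_def
  proof (rule the_equality)
    show "(\<forall>I. I \<notin> elem_indices n \<longrightarrow> c' I = 0) \<and> schubert n w = ?expand elem c'"
      using c(1) c'[of elem] by (simp add: c'_def)
  next
    fix d assume d: "(\<forall>I. I \<notin> elem_indices n \<longrightarrow> d I = 0) \<and> schubert n w = ?expand elem d"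
    show "d = c'"
    proof
      fix I show "d I = c' I"
        using d c(1) elem_product_coeff_unique[of d n c I] by (cases "I \<in> elem_indices n") (auto simp: c'_def)
    qed
  qed
  then show ?thesis
    using c(2) c'[of "qelem n"] by (simp add: qschubert_def)
qed

section \<open>The span of the elementary monomials is closed under divided differences\<close>

text \<open>The integer span of the elementary monomials, phrased as the domain of
  \<open>quantizes\<close> so that closure properties are inherited.\<close>

definition elem_span :: "nat \<Rightarrow> qpoly set"
  where "elem_span n = {F. \<exists>G. quantizes n F G}"

lemma elem_span_0: "0 \<in> elem_span n"
  using quantizes_0 by (auto simp: elem_span_def)

lemma elem_span_add: "F \<in> elem_span n \<Longrightarrow> G \<in> elem_span n \<Longrightarrow> F + G \<in> elem_span n"
  unfolding elem_span_def using quantizes_add by blast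

lemma elem_span_diff: "F \<in> elem_span n \<Longrightarrow> G \<in> elem_span n \<Longrightarrow> F - G \<in> elem_span n"
  unfolding elem_span_def using quantizes_diff by blast

lemma elem_span_scale: "F \<in> elem_span n \<Longrightarrow> of_int a * F \<in> elem_span n"
  unfolding elem_span_def using quantizes_scale by blast

lemma elem_span_sum: "(\<And>i. i \<in> A \<Longrightarrow> F i \<in> elem_span n) \<Longrightarrow> (\<Sum>i \<in> A. F i) \<in> elem_span n"
  by (induction A rule: infinite_finite_induct) (auto intro: elem_span_0 elem_span_add)

lemma elem_product_in_span: "elem_product elem n J \<in> elem_span n"
  using quantizes_elem_product by (auto simp: elem_span_def)

lemma elem_product_remove:
  assumes "1 \<le> k" "k < n"
  shows "elem_product g n I = (\<Prod>p \<in> {1..n-1} - {k}. g p (I p)) * g k (I k)"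
proof -
  have "elem_product g n I = g k (I k) * (\<Prod>p \<in> {1..n-1} - {k}. g p (I p))"
    using assms by (intro prod.remove) auto
  then show ?thesis
    by (simp only: mult.commute)
qed

lemma elem_product_remove2:
  assumes "1 \<le> m" "Suc m < n"
  shows "(\<Prod>p \<in> {1..n-1} - {m, Suc m}. g p (I p)) * g m a * g (Suc m) b
    = elem_product g n (I(m := a, Suc m := b))"
proof -
  let ?J = "I(m := a, Suc m := b)"
  have minus: "{1..n-1} - {m} - {Suc m} = {1..n-1} - {m, Suc m}"
    by auto
  have "elem_product g n ?J = g m (?J m) * (\<Prod>p \<in> {1..n-1} - {m}. g p (?J p))"
    using assms by (intro prod.remove) auto
  also have "(\<Prod>p \<in> {1..n-1} - {m}. g p (?J p))
      = g (Suc m) (?J (Suc m)) * (\<Prod>p \<in> {1..n-1} - {m, Suc m}. g p (?J p))"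
    using assms unfolding minus[symmetric] by (intro prod.remove) auto
  also have "(\<Prod>p \<in> {1..n-1} - {m, Suc m}. g p ((I(m := a, Suc m := b)) p))
      = (\<Prod>p \<in> {1..n-1} - {m, Suc m}. g p (I p))"
    by (intro prod.cong) auto
  finally have "elem_product g n ?J
      = g m a * (g (Suc m) b * (\<Prod>p \<in> {1..n-1} - {m, Suc m}. g p (I p)))"
    by (simp only: fun_upd_same fun_upd_other[OF n_not_Suc_n])
  then show ?thesis
    by (simp only: mult_ac)
qed

text \<open>Level m occurs twice while level m + 1 is vacant. One application of
  \<open>elem_straighten\<close> gives two products that use each level once, and one repeated
  product with smaller first index, covered by the induction on a.\<close>

lemma straighten_in_span:
  assumes "1 \<le> m" "Suc m < n"
  shows "(\<Prod>p \<in> {1..n-1} - {m, Suc m}. elem p (I p)) * (elem m a * elem m b) \<in> elem_span n"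
proof (induction a arbitrary: b)
  let ?P = "\<Prod>p \<in> {1..n-1} - {m, Suc m}. elem p (I p)"
  have span: "?P * (elem m a * elem (Suc m) b) \<in> elem_span n" for a b
    using elem_product_remove2[OF assms, of elem I a b] elem_product_in_span by (simp add: mult.assoc)
  {
    case 0
    show ?case using span[of b 0] by simp
  next
    case (Suc a)
    show ?case
      unfolding elem_straighten distrib_left right_diff_distrib
      by (intro elem_span_add elem_span_diff Suc.IH span)
  }
qed

text \<open>The operator turns the factor of level k into one of level k - 1. This level may now
  occur twice, but level k has become vacant, which is the situation of
  \<open>straighten_in_span\<close>.\<close>

lemma elem_product_divdiff:
  assumes k: "1 \<le> k" "k < n"
  shows "\<exists>G \<in> elem_span n. is_divdiff n (xact k) k (elem_product elem n I) G"
proof -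
  let ?P = "\<Prod>p \<in> {1..n-1} - {k}. elem p (I p)"
  have inv: "xact k ?P = ?P"
    unfolding xact.hom_prod using k by (intro prod.cong) (auto simp: xact_elem)
  have ring: "?P \<in> qring n"
    by (intro qring_prod elem_in_qring) auto
  have prod: "elem_product elem n I = ?P * elem k (I k)"
    by (rule elem_product_remove[OF k])
  show ?thesis
  proof (cases "I k")
    case 0
    with prod inv show ?thesis
      by (intro bexI[of _ 0]) (auto intro: is_divdiff_invariant elem_span_0 xact.comm_ring_hom_axioms)
  next
    case (Suc i)
    have "is_divdiff n (xact k) k (elem_product elem n I) (?P * elem (k - 1) i)"
      unfolding prod Suc
      by (intro is_divdiff_mult is_divdiff_elem k inv ring xact.comm_ring_hom_axioms)
    moreover have "?P * elem (k - 1) i \<in> elem_span n"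
    proof (cases "k = 1")
      \<comment> \<open>Level 0 contributes only the constants 1 and 0, so there is nothing to
        straighten.\<close>
      case True
      have "?P = elem_product elem n (I(1 := 0))"
        using k True by (subst elem_product_remove[of 1]) (auto intro: prod.cong)
      then show ?thesis
        using True elem_product_in_span[of "I(1 := 0)" n] elem_span_0 by (simp add: elem_0_left)
    next
      case False
      then obtain m where m: "k = Suc m" "1 \<le> m"
        using k by (cases k) auto
      have "?P = (\<Prod>p \<in> {1..n-1} - {m, Suc m}. elem p (I p)) * elem m (I m)"
      proof -
        have "{1..n-1} - {k} - {m} = {1..n-1} - {m, Suc m}"
          using m by auto
        then show ?thesis
          using m k by (subst prod.remove[of _ m]) (auto simp: mult.commute)
      qed
      then show ?thesis
        using straighten_in_span[where n = n and m = m and I = I and a = "I m" and b = i] m k by (simp add: mult.assoc)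
    qed
    ultimately show ?thesis by blast
  qed
qed

text \<open>By linearity. On the span, \<open>xpd\<close> is thereby known to be the true quotient
  and can be iterated.\<close>

lemma elem_span_divdiff:
  assumes "F \<in> elem_span n" "1 \<le> k" "k < n"
  shows "is_divdiff n (xact k) k F (xpd n k F)" "xpd n k F \<in> elem_span n"
proof -
  obtain c where F: "F = (\<Sum>I \<in> elem_indices n. of_int (c I) * elem_product elem n I)"
    using assms(1) unfolding elem_span_def quantizes_def by blast
  obtain D where D: "D I \<in> elem_span n" "is_divdiff n (xact k) k (elem_product elem n I) (D I)" for I
    using elem_product_divdiff[OF assms(2,3)] by metis
  let ?G = "\<Sum>I \<in> elem_indices n. of_int (c I) * D I"
  have "is_divdiff n (xact k) k F ?G"
    unfolding F by (intro is_divdiff_sum is_divdiff_of_int_mult D xact.comm_ring_hom_axioms)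
  moreover have "?G \<in> elem_span n"
    by (intro elem_span_sum elem_span_scale D)
  ultimately show "is_divdiff n (xact k) k F (xpd n k F)" "xpd n k F \<in> elem_span n"
    by (simp_all add: xpd_def divdiff_eqI)
qed

section \<open>Commutation and braid relations\<close>

text \<open>Multiplied by both denominators, each side becomes F - s_k F - s_l F + s_k s_l
  F.\<close>

lemma xpd_commute:
  assumes F: "F \<in> elem_span n" and k: "1 \<le> k" "k + 1 < l" "l < n"
  shows "xpd n k (xpd n l F) = xpd n l (xpd n k F)"
proof -
  let ?a = "xx k - xx (k + 1)" and ?b = "xx l - xx (l + 1)"
  note D = elem_span_divdiff
  have a_b: "xact l ?a = ?a" "xact k ?b = ?b"
    using k by (auto simp: xact.hom_minus transpose_def)
  have l: "?b * xpd n l F = F - xact l F"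
    and k': "?a * xpd n k F = F - xact k F"
    and kl: "?a * xpd n k (xpd n l F) = xpd n l F - xact k (xpd n l F)"
    and lk: "?b * xpd n l (xpd n k F) = xpd n k F - xact l (xpd n k F)"
    using D[of _ n] F k by (simp_all add: is_divdiff_def)
  from arg_cong[OF l, of "xact k"] have kl': "?b * xact k (xpd n l F) = xact k F - xact k (xact l F)"
    by (simp only: xact.hom_mult xact.hom_minus[of _ F] a_b)
  from arg_cong[OF k', of "xact l"] have lk': "?a * xact l (xpd n k F) = xact l F - xact l (xact k F)"
    by (simp only: xact.hom_mult xact.hom_minus[of _ F] a_b)
  have "?b * (?a * xpd n k (xpd n l F)) = ?b * xpd n l F - ?b * xact k (xpd n l F)"
    by (simp only: kl right_diff_distrib)
  also have "\<dots> = F - xact l F - (xact k F - xact k (xact l F))"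
    by (simp only: l kl')
  also have "\<dots> = F - xact k F - (xact l F - xact l (xact k F))"
    using xact_commute[OF k(2)] by simp
  also have "\<dots> = ?a * (?b * xpd n l (xpd n k F))"
    by (simp only: lk right_diff_distrib k' lk')
  finally have "(?a * ?b) * xpd n k (xpd n l F) = (?a * ?b) * xpd n l (xpd n k F)"
    by (simp only: mult_ac)
  moreover have "?a * ?b \<noteq> 0"
    by simp
  ultimately show ?thesis
    by (simp only: mult_cancel_left) simp
qed

text \<open>The triple divided difference is the alternating sum over S_3 divided by a b (a + b).
  Abstract homomorphisms s and t let one computation serve both sides of the braid relation, with
  the roles exchanged.\<close>

lemma braid_expansion:
  fixes a b :: "'a :: comm_ring_1"
  assumes "comm_ring_hom s" "comm_ring_hom t"
    and ab: "s a = - a" "t b = - b" "s b = a + b" "t a = a + b"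
    and invol: "s (s F) = F"
    and G1: "a * G1 = F - s F" and G2: "b * G2 = G1 - t G1" and G3: "a * G3 = G2 - s G2"
  shows "a * (a * b * (a + b) * G3)
    = a * (F - s F - t F + s (t F) + t (s F) - s (t (s F)))"
proof -
  interpret s: comm_ring_hom s by fact
  interpret t: comm_ring_hom t by fact
  from arg_cong[OF G1, of t] have t1: "(a + b) * t G1 = t F - t (s F)"
    by (simp only: t.hom_mult t.hom_minus ab)
  from arg_cong[OF G1, of s] have s1: "a * s G1 = F - s F"
    by (simp add: s.hom_mult s.hom_minus ab invol)
      (metis minus_diff_eq neg_equal_iff_equal)
  from arg_cong[OF t1, of s] have st1: "b * s (t G1) = s (t F) - s (t (s F))"
    by (simp only: s.hom_mult s.hom_minus s.hom_add ab) simp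
  from arg_cong[OF G2, of s] have s2: "(a + b) * s G2 = s G1 - s (t G1)"
    by (simp only: s.hom_mult s.hom_minus ab)
  \<comment> \<open>The extra factor a is there because G1 and s G1 are expressible through F only
    after multiplication by a.\<close>
  have "a * (a * b * (a + b) * G3) = a * b * (a + b) * (a * G3)"
    by (simp only: mult_ac)
  also have "\<dots> = a * (a + b) * (b * G2) - a * b * ((a + b) * s G2)"
    unfolding G3 by (simp add: algebra_simps)
  also have "\<dots> = (a + b) * (a * G1) - a * ((a + b) * t G1) - b * (a * s G1) + a * (b * s (t G1))"
    unfolding G2 s2 by (simp add: algebra_simps)
  also have "\<dots> = a * (F - s F - t F + s (t F) + t (s F) - s (t (s F)))"
    unfolding G1 t1 s1 st1 by (simp add: algebra_simps)
  finally show ?thesis .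
qed

text \<open>Both sides have the same denominator, and the alternating sums agree by the braid
  relation of the action.\<close>

lemma xpd_braid:
  assumes F: "F \<in> elem_span n" and k: "1 \<le> k" "k + 1 < n"
  shows "xpd n k (xpd n (k + 1) (xpd n k F)) = xpd n (k + 1) (xpd n k (xpd n (k + 1) F))"
    (is "?G = ?H")
proof -
  let ?a = "xx k - xx (k + 1)" and ?b = "xx (k + 1) - xx (k + 2)"
  let ?alt = "F - xact k F - xact (k + 1) F + xact k (xact (k + 1) F) + xact (k + 1) (xact k F)
    - xact k (xact (k + 1) (xact k F))"
  have ab: "xact k ?a = - ?a" "xact (k + 1) ?b = - ?b" "xact k ?b = ?a + ?b" "xact (k + 1) ?a = ?a + ?b"
    by (auto simp: xact.hom_minus transpose_def)
  have ba: "xact k ?b = ?b + ?a" "xact (k + 1) ?a = ?b + ?a"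
    using ab by (simp_all add: add.commute)
  have D: "(xx k - xx (k + 1)) * xpd n k F = F - xact k F"
    "(xx (k + 1) - xx (k + 2)) * xpd n (k + 1) F = F - xact (k + 1) F"
    if "F \<in> elem_span n" for F
    using that elem_span_divdiff(1)[of F n k] elem_span_divdiff(1)[of F n "k + 1"] k
    by (simp_all add: is_divdiff_def)
  have mem: "xpd n k F \<in> elem_span n" "xpd n (k + 1) F \<in> elem_span n" if "F \<in> elem_span n" for F
    using that k by (auto intro: elem_span_divdiff(2))
  note hom = xact.comm_ring_hom_axioms
  have "?a * (?a * ?b * (?a + ?b) * ?G) = ?a * ?alt"
    by (rule braid_expansion[where s = "xact k" and t = "xact (k + 1)", OF hom hom ab xact_involution
          D(1)[OF F] D(2)[OF mem(1)[OF F]] D(1)[OF mem(2)[OF mem(1)[OF F]]]])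
  then have G: "?a * ?b * (?a + ?b) * ?G = ?alt"
    by simp
  have "?b * (?b * ?a * (?b + ?a) * ?H) = ?b * (F - xact (k + 1) F - xact k F
      + xact (k + 1) (xact k F) + xact k (xact (k + 1) F) - xact (k + 1) (xact k (xact (k + 1) F)))"
    by (rule braid_expansion[where s = "xact (k + 1)" and t = "xact k",
          OF hom hom ab(2,1) ba(2,1) xact_involution
          D(2)[OF F] D(1)[OF mem(2)[OF F]] D(2)[OF mem(1)[OF mem(2)[OF F]]]])
  then have "?b * ?a * (?b + ?a) * ?H = F - xact (k + 1) F - xact k F
      + xact (k + 1) (xact k F) + xact k (xact (k + 1) F) - xact (k + 1) (xact k (xact (k + 1) F))"
    by simp
  also have "\<dots> = ?alt"
    by (simp only: xact_braid) simp
  finally have H: "?a * ?b * (?a + ?b) * ?H = ?alt"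
    by (simp only: mult_ac add.commute)
  have "?a * ?b * (?a + ?b) \<noteq> 0"
    by simp
  with G H show ?thesis
    by (metis mult_cancel_left)
qed

section \<open>Schubert polynomials are well defined\<close>

text \<open>Right multiplication by an ascent lowers this weight, so it serves as induction measure
  in place of the colength.\<close>

definition perm_weight :: "nat \<Rightarrow> (nat \<Rightarrow> nat) \<Rightarrow> nat"
  where "perm_weight n w = (\<Sum>i = 1..n. i * w i)"

text \<open>Rearrangement inequality for the two terms that change.\<close>

lemma perm_weight_ascent:
  assumes "1 \<le> k" "k < n" "w k < w (k + 1)"
  shows "perm_weight n (w \<circ> adj_transp k) < perm_weight n w"
proof -
  have split: "(\<Sum>i = 1..n. f i) = f k + f (k + 1) + (\<Sum>i \<in> {1..n} - {k, k + 1}. f i)" for f :: "nat \<Rightarrow> nat"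
  proof -
    have "{1..n} = insert k (insert (k + 1) ({1..n} - {k, k + 1}))"
      using assms by auto
    then have "(\<Sum>i = 1..n. f i) = (\<Sum>i \<in> insert k (insert (k + 1) ({1..n} - {k, k + 1})). f i)"
      by simp
    then show ?thesis
      by (simp add: sum.insert)
  qed
  have rest: "(\<Sum>i \<in> {1..n} - {k, k + 1}. i * (w \<circ> adj_transp k) i) = (\<Sum>i \<in> {1..n} - {k, k + 1}. i * w i)"
    by (intro sum.cong) (auto simp: transpose_def)
  have "k * w (k + 1) + (k + 1) * w k < k * w k + (k + 1) * w (k + 1)"
    using assms(3) by simp
  then show ?thesis
    unfolding perm_weight_def split rest by simp
qed

lemma permutes_comp_adj_transp:
  assumes "w permutes {1..n}" "1 \<le> k" "k < n"
  shows "w \<circ> adj_transp k permutes {1..n}"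
  using assms by (intro permutes_compose permutes_swap_id) auto

lemma permutes_adjacent_neq: "(w :: nat \<Rightarrow> nat) permutes A \<Longrightarrow> w k \<noteq> w (k + 1)"
  by (simp add: inj_eq[OF permutes_inj])

lemma comp_transpose_involution [simp]: "w \<circ> Transposition.transpose a b \<circ> Transposition.transpose a b = w"
  by (simp add: comp_assoc)

text \<open>Descents everywhere make w i + i weakly decreasing; its values at n and 1 squeeze it to
  n + 1.\<close>

lemma permutes_no_ascent:
  assumes w: "w permutes {1..n}" and desc: "\<And>k. 1 \<le> k \<Longrightarrow> k < n \<Longrightarrow> w (k + 1) < w k"
  shows "w = longest_perm n"
proof
  fix i
  have mono: "w j + j \<le> w i + i" if "i \<le> j" "1 \<le> i" "j \<le> n" for i j
    using that
  proof (induction j rule: dec_induct)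
    case (step j)
    then show ?case using desc[of j] by simp
  qed simp
  show "w i = longest_perm n i"
  proof (cases "i \<in> {1..n}")
    case True
    then have "w n + n \<le> w i + i" "w i + i \<le> w 1 + 1"
      using mono[of i n] mono[of 1 i] by auto
    moreover have "1 \<le> w n" "w 1 \<le> n"
      using True permutes_in_image[OF w, of n] permutes_in_image[OF w, of 1] by auto
    ultimately show ?thesis
      using True by (simp add: longest_perm_def)
  next
    case False
    then show ?thesis
      using permutes_not_in[OF w False] by (auto simp: longest_perm_def)
  qed
qed

text \<open>The staircase monomial is the product of all e_p^(p), since x_i divides exactly those
  with p at least i.\<close>

lemma top_schubert_in_span: "(\<Prod>i = 1..n. xx i ^ (n - i)) \<in> elem_span n"
proof (cases n)
  case 0
  then show ?thesis
    using elem_product_in_span[of "\<lambda>p. p" 0] by simp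
next
  case (Suc m)
  have "(\<Prod>p = 1..m. elem p p) = (\<Prod>i = 1..Suc m. xx i ^ (Suc m - i))"
  proof (induction m)
    case (Suc m)
    have "(\<Prod>i = 1..Suc (Suc m). xx i ^ (Suc (Suc m) - i)) = (\<Prod>i = 1..Suc m. xx i ^ (Suc m - i) * xx i)"
      by (simp add: Suc_diff_le power_commutes)
    also have "\<dots> = (\<Prod>p = 1..m. elem p p) * elem (Suc m) (Suc m)"
      by (simp only: prod.distrib Suc elem_self[of "Suc m"])
    finally show ?case
      by simp
  qed simp
  with Suc show ?thesis
    using elem_product_in_span[of "\<lambda>p. p" n] by simp
qed

lemma is_schubert_in_span: "is_schubert n w F \<Longrightarrow> F \<in> elem_span n"
proof (induction rule: is_schubert.induct)
  case top
  show ?case by (rule top_schubert_in_span)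
next
  case (step w F k)
  then show ?case by (intro elem_span_divdiff)
qed

text \<open>By induction on the weight, uniqueness is known for every w s_k at an ascent k. Any two
  ascents give the same value at w, by commutation or the braid relation. Without ascents w is the
  longest permutation and only the rule \<open>top\<close> can apply.\<close>

lemma is_schubert_ex1:
  assumes "w permutes {1..n}"
  shows "\<exists>!F. is_schubert n w F"
  using assms
proof (induction "perm_weight n w" arbitrary: w rule: less_induct)
  case less
  have S: "is_schubert n u (schubert n u)" and S_unique: "is_schubert n u F \<Longrightarrow> F = schubert n u"
    if "perm_weight n u < perm_weight n w" "u permutes {1..n}" for u F
    using less.hyps[OF that] unfolding schubert_def by (auto intro: theI' the1_equality[symmetric])
  have S_span: "schubert n u \<in> elem_span n"
    if "perm_weight n u < perm_weight n w" "u permutes {1..n}" for u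
    using S[OF that] by (rule is_schubert_in_span)
  have S_step: "schubert n v = xpd n k (schubert n (v \<circ> adj_transp k))"
    if "perm_weight n v < perm_weight n w" "v permutes {1..n}" "1 \<le> k" "k < n" "v k < v (k + 1)" for v k
  proof -
    let ?u = "v \<circ> adj_transp k"
    have u: "?u permutes {1..n}" "perm_weight n ?u < perm_weight n w"
      using permutes_comp_adj_transp perm_weight_ascent[of k n v] that by auto
    then have "is_schubert n (?u \<circ> adj_transp k) (xpd n k (schubert n ?u))"
      using that by (intro is_schubert.step S) auto
    then show ?thesis
      using S_unique[OF that(1,2)] by simp
  qed
  \<comment> \<open>The value forced on w by its ascent k.\<close>
  let ?cand = "\<lambda>k. xpd n k (schubert n (w \<circ> adj_transp k))"
  have cand_less: "?cand k = ?cand l"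
    if k: "1 \<le> k" "w k < w (k + 1)" and l: "l < n" "w l < w (l + 1)" and "k < l" for k l
  proof -
    let ?a = "w \<circ> adj_transp k" and ?a' = "w \<circ> adj_transp l"
    have "k < n" "1 \<le> l" using that by auto
    note kl = k(1) this(2) this(1) l(1)
    have a: "?a permutes {1..n}" "?a' permutes {1..n}"
      "perm_weight n ?a < perm_weight n w" "perm_weight n ?a' < perm_weight n w"
      by (rule permutes_comp_adj_transp[OF less.prems kl(1,3)]
          permutes_comp_adj_transp[OF less.prems kl(2,4)]
          perm_weight_ascent[OF kl(1,3) k(2)] perm_weight_ascent[OF kl(2,4) l(2)])+
    show ?thesis
    proof (cases "l = k + 1")
      case False
      then have far: "k + 1 < l" using \<open>k < l\<close> by simp
      \<comment> \<open>Distant ascents: w s_k s_l = w s_l s_k is reached through either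
        one.\<close>
      let ?b = "?a \<circ> adj_transp l"
      have b: "?b = ?a' \<circ> adj_transp k"
        using far by (auto simp: fun_eq_iff transpose_def)
      have asc: "?a l < ?a (l + 1)" "?a' k < ?a' (k + 1)"
        using far that by (auto simp: transpose_def)
      have "perm_weight n ?b < perm_weight n ?a" "?b permutes {1..n}"
        by (rule permutes_comp_adj_transp[OF a(1) kl(2,4)] perm_weight_ascent[OF kl(2,4) asc(1)])+
      then have span: "schubert n ?b \<in> elem_span n"
        using a(3) by (intro S_span) simp_all
      have "?cand k = xpd n k (xpd n l (schubert n ?b))"
        by (simp only: S_step[OF a(3,1) kl(2,4) asc(1)])
      also have "\<dots> = xpd n l (xpd n k (schubert n ?b))"
        by (rule xpd_commute[OF span kl(1) far l(1)])
      also have "\<dots> = ?cand l"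
        by (simp only: S_step[OF a(4,2) kl(1,3) asc(2)] b)
      finally show ?thesis .
    next
      case True
      let ?b = "?a \<circ> adj_transp l" and ?b' = "?a' \<circ> adj_transp k"
      let ?c = "?b \<circ> adj_transp k"
      have c: "?c = ?b' \<circ> adj_transp l"
        using True by (auto simp: fun_eq_iff transpose_def)
      \<comment> \<open>Here w k < w (k + 1) < w (k + 2), so all steps on both ways to w s_k s_l s_k
        = w s_l s_k s_l are ascents.\<close>
      have asc: "?a l < ?a (l + 1)" "?a' k < ?a' (k + 1)" "?b k < ?b (k + 1)" "?b' l < ?b' (l + 1)"
        using True that by (auto simp: transpose_def)
      have b: "?b permutes {1..n}" "?b' permutes {1..n}"
        "perm_weight n ?b < perm_weight n w" "perm_weight n ?b' < perm_weight n w"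
        by (rule permutes_comp_adj_transp[OF a(1) kl(2,4)] permutes_comp_adj_transp[OF a(2) kl(1,3)]
            less_trans[OF perm_weight_ascent[OF kl(2,4) asc(1)] a(3)]
            less_trans[OF perm_weight_ascent[OF kl(1,3) asc(2)] a(4)])+
      have "?c permutes {1..n}" "perm_weight n ?c < perm_weight n w"
        by (rule permutes_comp_adj_transp[OF b(1) kl(1,3)]
            less_trans[OF perm_weight_ascent[OF kl(1,3) asc(3)] b(3)])+
      then have span: "schubert n ?c \<in> elem_span n"
        by (intro S_span)
      have "?cand k = xpd n k (xpd n l (xpd n k (schubert n ?c)))"
        by (simp only: S_step[OF a(3,1) kl(2,4) asc(1)] S_step[OF b(3,1) kl(1,3) asc(3)])
      also have "\<dots> = xpd n l (xpd n k (xpd n l (schubert n ?c)))"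
        using xpd_braid[OF span kl(1)] kl(4) True by simp
      also have "\<dots> = ?cand l"
        by (simp only: S_step[OF a(4,2) kl(1,3) asc(2)] S_step[OF b(4,2) kl(2,4) asc(4)] c)
      finally show ?thesis .
    qed
  qed
  have cand: "?cand k = ?cand l"
    if "1 \<le> k" "k < n" "w k < w (k + 1)" "1 \<le> l" "l < n" "w l < w (l + 1)" for k l
    using cand_less[of k l] cand_less[of l k] that by (cases k l rule: linorder_cases) auto
  show ?case
  proof (cases "\<exists>k. 1 \<le> k \<and> k < n \<and> w k < w (k + 1)")
    case True
    then obtain k where k: "1 \<le> k" "k < n" "w k < w (k + 1)" by blast
    let ?u = "w \<circ> adj_transp k"
    have u: "?u permutes {1..n}" "perm_weight n ?u < perm_weight n w"
      by (rule permutes_comp_adj_transp[OF less.prems k(1,2)] perm_weight_ascent[OF k])+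
    show ?thesis
    proof (rule ex1I)
      have "is_schubert n (?u \<circ> adj_transp k) (?cand k)"
        using k u by (intro is_schubert.step S) auto
      then show "is_schubert n w (?cand k)" by simp
    next
      fix F assume "is_schubert n w F"
      then show "F = ?cand k"
      proof cases
        \<comment> \<open>The longest permutation has no ascent.\<close>
        case top
        with k show ?thesis by (auto simp: longest_perm_def split: if_splits)
      next
        case (step u F' l)
        have u: "u = w \<circ> adj_transp l"
          unfolding step(1) by simp
        have "w l < w (l + 1)"
          unfolding step(1) using step(7) by simp
        note l = step(5,6) this
        have "F' = schubert n u"
        proof (rule S_unique)
          show "perm_weight n u < perm_weight n w"
            unfolding u by (rule perm_weight_ascent[OF l])
        qed (rule step)+
        then have "F = ?cand l"
          by (simp only: step(2) flip: u)
        also have "\<dots> = ?cand k"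
          by (rule cand[OF l k])
        finally show ?thesis .
      qed
    qed
  next
    case False
    then have longest: "w = longest_perm n"
      using permutes_adjacent_neq[OF less.prems]
      by (intro permutes_no_ascent less.prems) (metis linorder_neqE_nat)
    show ?thesis
    proof (rule ex1I)
      show "is_schubert n w (\<Prod>i = 1..n. xx i ^ (n - i))"
        unfolding longest by (rule is_schubert.top)
    next
      fix F assume "is_schubert n w F"
      then show "F = (\<Prod>i = 1..n. xx i ^ (n - i))"
      proof cases
        case (step u F' l)
        have "w l < w (l + 1)"
          unfolding step(1) using step(7) by simp
        with step(5,6) False show ?thesis by blast
      qed
    qed
  qed
qed

lemma is_schubert_schubert: "w permutes {1..n} \<Longrightarrow> is_schubert n w (schubert n w)"
  unfolding schubert_def by (rule theI') (rule is_schubert_ex1)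

lemma schubert_eqI: "w permutes {1..n} \<Longrightarrow> is_schubert n w F \<Longrightarrow> schubert n w = F"
  unfolding schubert_def by (rule the1_equality) (rule is_schubert_ex1)

lemma schubert_in_span: "w permutes {1..n} \<Longrightarrow> schubert n w \<in> elem_span n"
  by (blast intro: is_schubert_in_span is_schubert_schubert)

lemma schubert_descent:
  assumes "w permutes {1..n}" "1 \<le> k" "k < n" "w (k + 1) < w k"
  shows "schubert n (w \<circ> adj_transp k) = xpd n k (schubert n w)"
  using assms
  by (intro schubert_eqI is_schubert.step is_schubert_schubert permutes_comp_adj_transp)

text \<open>At an ascent the Schubert polynomial is itself a value of \<partial>_k, hence
  s_k-invariant.\<close>

lemma schubert_ascent:
  assumes w: "w permutes {1..n}" "1 \<le> k" "k < n" "w k < w (k + 1)"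
  shows "xpd n k (schubert n w) = 0"
proof -
  let ?u = "w \<circ> adj_transp k"
  have u: "?u permutes {1..n}"
    using w by (intro permutes_comp_adj_transp)
  have "schubert n w = xpd n k (schubert n ?u)"
    using schubert_descent[OF u w(2,3)] w(4) by simp
  moreover have "is_divdiff n (xact k) k (schubert n ?u) (xpd n k (schubert n ?u))"
    using u w by (intro elem_span_divdiff schubert_in_span)
  ultimately have "is_divdiff n (xact k) k (schubert n ?u) (schubert n w)"
    by (simp only:)
  then have "xact k (schubert n w) = schubert n w"
    by (rule invariant_divdiff[OF xact.comm_ring_hom_axioms _ _ xact_involution, rotated 2]) simp_all
  then show ?thesis
    by (simp add: xpd_def divdiff_eqI is_divdiff_invariant xact.comm_ring_hom_axioms)
qed

section \<open>Quantized elementary polynomials and the action on \<open>R\<^sub>n\<close>\<close>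

interpretation qact: comm_ring_hom "qact n k" for n k
  unfolding qact_def by (rule subst.comm_ring_hom_axioms)

lemma qact_xx [simp]: "qact n k (xx i) = xx (adj_transp k i)"
  by (simp add: qact_def xx_def)

lemma qact_qq:
  assumes "1 \<le> i" "i < j" "j \<le> n"
  shows "qact n k (qq n i j) =
    (if k + 1 = j then qq n i j - qq n i (j - 1) * (xx (j - 1) - xx j)
     else if k = i then qq n i j + qq n (i + 1) j * (xx i - xx (i + 1))
     else qq n i j)"
proof -
  have "qq n i j = var (Q i j)"
    using assms by (simp add: qq_def)
  then have "qact n k (qq n i j) = qact_var n k (Q i j)"
    by (simp only: qact_def subst_var)
  then show ?thesis
    by (simp only: qact_var.simps)
qed

lemma qmatrix_carrier [simp]: "qmatrix n j \<in> carrier_mat j j"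
  by (simp add: qmatrix_def)

text \<open>All indices in the matrix are at most j < k, so no entry is moved.\<close>

lemma qact_qmatrix_less:
  assumes "j \<le> n" "j < k"
  shows "map_mat (qact n k) (qmatrix n j) = qmatrix n j"
proof (rule eq_matI)
  fix a b assume "a < dim_row (qmatrix n j)" "b < dim_col (qmatrix n j)"
  then have ab: "a < j" "b < j"
    by (simp_all add: qmatrix_def)
  consider "a = b" | "a < b" | "b < a" by linarith
  then show "map_mat (qact n k) (qmatrix n j) $$ (a, b) = qmatrix n j $$ (a, b)"
  proof cases
    case 2
    with ab assms show ?thesis
      using qact_qq[of "a + 1" "b + 1" n k] by (simp add: qmatrix_def)
  qed (use ab assms in \<open>simp_all add: qmatrix_def transpose_def qact.hom_uminus\<close>)
qed (simp_all add: qmatrix_def)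

text \<open>Conjugation by an elementary matrix swaps the diagonal entries \<open>x\<^sub>k\<close> and \<open>x\<^sub>k\<^sub>+\<^sub>1\<close>
  thanks to the entry \<open>-1\<close> below the diagonal.\<close>

lemma qact_qmatrix_greater:
  assumes "1 \<le> k" "k < j" "j \<le> n"
  shows "map_mat (qact n k) (qmatrix n j)
    = add_col_sub_row (- (xx k - xx (k + 1))) (k - 1) k (qmatrix n j)"
proof (rule eq_matI)
  let ?B = "add_col_sub_row (- (xx k - xx (k + 1))) (k - 1) k (qmatrix n j)"
  obtain m where m: "k = Suc m" using assms(1) by (cases k) auto
  fix a b assume "a < dim_row ?B" "b < dim_col ?B"
  then have ab: "a < j" "b < j"
    by (simp_all add: qmatrix_def)
  have dim: "dim_row (qmatrix n j) = j" "dim_col (qmatrix n j) = j"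
    by (simp_all add: qmatrix_def)
  have M: "qmatrix n j $$ (a, b) = (if a = b then xx (a + 1)
           else if a < b then qq n (a + 1) (b + 1) else if a = b + 1 then - 1 else 0)"
    if "a < j" "b < j" for a b
    using that by (simp add: qmatrix_def)
  \<comment> \<open>Counted from 0, the indices m and k stand for k and k + 1. The row operation
    changes row m, the column operation changes column k, and they meet in the entry (m, k).\<close>
  have B: "?B $$ (a, b) =
    (if a = m \<and> b = k then
       qmatrix n j $$ (a, b) - (xx k - xx (k + 1)) * qmatrix n j $$ (a, a)
       - (xx k - xx (k + 1)) * (xx k - xx (k + 1)) * qmatrix n j $$ (b, a)
       + (xx k - xx (k + 1)) * qmatrix n j $$ (b, b)
     else if a = m then qmatrix n j $$ (a, b) + (xx k - xx (k + 1)) * qmatrix n j $$ (k, b)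
     else if b = k then qmatrix n j $$ (a, b) - (xx k - xx (k + 1)) * qmatrix n j $$ (a, m)
     else qmatrix n j $$ (a, b))"
    using ab assms m by (subst add_col_sub_index_row) (auto simp: dim algebra_simps)
  consider "a = b" | "a < b" | "b < a" by linarith
  then show "map_mat (qact n k) (qmatrix n j) $$ (a, b) = ?B $$ (a, b)"
  proof cases
    case 1
    with ab assms m show ?thesis
      unfolding B by (auto simp: dim M transpose_def)
  next
    case 2
    have "map_mat (qact n k) (qmatrix n j) $$ (a, b) = qact n k (qq n (a + 1) (b + 1))"
      using ab 2 by (simp add: dim M)
    \<comment> \<open>At (m, k), that is at q_(k,k+1), the square of x_k - x_(k+1) coming from the
      entry -1 cancels against the diagonal contributions, in accordance with the invariance of this
      variable.\<close>
    also have "\<dots> = ?B $$ (a, b)"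
      unfolding B using 2 ab assms m
      by (subst qact_qq) (auto simp: M qq_def algebra_simps)
    finally show ?thesis .
  next
    case 3
    with ab assms m show ?thesis
      unfolding B by (auto simp: dim M qact.hom_uminus)
  qed
qed (simp_all add: qmatrix_def)

text \<open>Applying a homomorphism to the entries applies it to the coefficients of the
  characteristic polynomial, and similar matrices share that polynomial.\<close>

lemma qact_qelem:
  assumes "1 \<le> k" "j \<le> n" "j \<noteq> k"
  shows "qact n k (qelem n j i) = qelem n j i"
proof -
  have "char_poly (map_mat (qact n k) (qmatrix n j)) = char_poly (qmatrix n j)"
  proof (cases "j < k")
    case True
    with assms show ?thesis by (simp add: qact_qmatrix_less)
  next
    case False
    with assms show ?thesis
      by (subst qact_qmatrix_greater)
        (auto intro!: char_poly_similar add_col_sub_row_similar[where n = j])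
  qed
  then have "map_poly (qact n k) (char_poly (qmatrix n j)) = char_poly (qmatrix n j)"
    by (simp add: qact.char_poly_hom[OF qmatrix_carrier])
  then have "qact n k (coeff (char_poly (qmatrix n j)) l) = coeff (char_poly (qmatrix n j)) l" for l
    by (metis coeff_map_poly qact.hom_zero)
  then show ?thesis
    by (simp add: qelem_def qact.hom_mult qact.hom_power qact.hom_uminus)
qed

section \<open>The quantized elementary polynomials lie in the subring\<close>

definition qring_poly :: "nat \<Rightarrow> qpoly poly set"
  where "qring_poly n = {p. \<forall>i. coeff p i \<in> qring n}"

lemma qring_poly_mult: "p \<in> qring_poly n \<Longrightarrow> q \<in> qring_poly n \<Longrightarrow> p * q \<in> qring_poly n"
  by (simp add: qring_poly_def coeff_mult qring_sum qring_mult)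

lemma qring_poly_sum: "(\<And>i. i \<in> A \<Longrightarrow> p i \<in> qring_poly n) \<Longrightarrow> (\<Sum>i \<in> A. p i) \<in> qring_poly n"
  by (simp add: qring_poly_def coeff_sum qring_sum)

lemma qring_poly_pCons: "a \<in> qring n \<Longrightarrow> p \<in> qring_poly n \<Longrightarrow> pCons a p \<in> qring_poly n"
  by (simp add: qring_poly_def coeff_pCons split: nat.split)

lemma qring_poly_0: "0 \<in> qring_poly n"
  by (simp add: qring_poly_def)

lemma qring_poly_prod: "(\<And>i. i \<in> A \<Longrightarrow> p i \<in> qring_poly n) \<Longrightarrow> (\<Prod>i \<in> A. p i) \<in> qring_poly n"
proof (induction A rule: infinite_finite_induct)
  case (insert a A)
  then show ?case by (simp add: qring_poly_mult)
qed (simp_all add: one_pCons qring_poly_pCons qring_poly_0)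

lemma char_poly_matrix_qmatrix:
  "a < j \<Longrightarrow> b < j \<Longrightarrow> char_poly_matrix (qmatrix n j) $$ (a, b)
    = [:- qmatrix n j $$ (a, b), if a = b then 1 else 0:]"
  by (simp add: char_poly_matrix_def qmatrix_def)

text \<open>Read off from the Leibniz expansion of the determinant, whose factors all have
  coefficients in the subring.\<close>

lemma qelem_in_qring:
  assumes "j \<le> n"
  shows "qelem n j i \<in> qring n"
proof -
  let ?C = "char_poly_matrix (qmatrix n j)"
  have entry: "?C $$ (a, b) \<in> qring_poly n" if "a < j" "b < j" for a b
  proof -
    have M: "qmatrix n j $$ (a, b) \<in> qring n"
      using that assms by (auto simp: qmatrix_def intro!: qring_intros)
    show ?thesis
      unfolding char_poly_matrix_qmatrix[OF that]
      by (intro qring_poly_pCons qring_poly_0 qring_uminus M) simp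
  qed
  have sign: "signof p \<in> qring_poly n" for p
    by (auto simp: sign_def one_pCons intro!: qring_poly_pCons qring_poly_0 qring_uminus)
  have "char_poly (qmatrix n j) \<in> qring_poly n"
    unfolding char_poly_def det_def'[OF char_poly_matrix_closed[OF qmatrix_carrier]]
    by (intro qring_poly_sum qring_poly_mult qring_poly_prod sign entry)
      (auto dest: permutes_in_image)
  moreover have "(- 1) ^ i \<in> qring n"
    by (cases "even i") (simp_all add: qring_uminus)
  ultimately show ?thesis
    by (auto simp: qelem_def qring_poly_def intro!: qring_mult)
qed

section \<open>Explicit formulas for sizes 1 and 2\<close>

lemma char_poly_qmatrix_1: "char_poly (qmatrix n 1) = [:- xx 1, 1:]"
  unfolding char_poly_def
  by (subst det_single) (simp_all add: char_poly_matrix_def qmatrix_def)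

lemma char_poly_qmatrix_2:
  assumes "2 \<le> n"
  shows "char_poly (qmatrix n 2) = [:xx 1 * xx 2 + qq n 1 2, - (xx 1 + xx 2), 1:]"
proof -
  let ?s = "Transposition.transpose 0 (1 :: nat)"
  have set: "{0..<2::nat} = {0, 1}" by auto
  have perms: "{p. p permutes {0..<2::nat}} = {id, ?s}"
    unfolding set by (auto simp: permutes_doubleton_iff)
  have "id \<noteq> ?s"
    by (metis id_apply transpose_apply_first zero_neq_one)
  then have "char_poly (qmatrix n 2)
      = (\<Prod>i = 0..<2. char_poly_matrix (qmatrix n 2) $$ (i, i))
        - (\<Prod>i = 0..<2. char_poly_matrix (qmatrix n 2) $$ (i, ?s i))"
    unfolding char_poly_def det_def'[OF char_poly_matrix_closed[OF qmatrix_carrier]] perms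
    by (simp add: sign_swap_id)
  \<comment> \<open>Off the diagonal, t I - M has the entries -q_12 and +1, so q_12 enters the
    determinant with a plus sign.\<close>
  also have "\<dots> = [:- xx 1, 1:] * [:- xx 2, 1:] - [:- qq n 1 2:] * [:1:]"
    unfolding set by (simp add: char_poly_matrix_qmatrix) (simp add: qmatrix_def numeral_2_eq_2)
  finally show ?thesis
    by (simp add: numeral_2_eq_2 algebra_simps)
qed

lemma qelem_1_1: "qelem n 1 1 = xx 1"
  using char_poly_qmatrix_1[of n] by (simp add: qelem_def)

lemma qelem_2_1: "2 \<le> n \<Longrightarrow> qelem n 2 1 = xx 1 + xx 2"
  using char_poly_qmatrix_2[of n] by (simp add: qelem_def)

lemma qelem_2_2: "2 \<le> n \<Longrightarrow> qelem n 2 2 = xx 1 * xx 2 + qq n 1 2"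
  using char_poly_qmatrix_2[of n] by (simp add: qelem_def)

section \<open>The quantum divided differences on quantized elementary monomials\<close>

text \<open>For \<open>k = 2\<close> the witnesses are the intermediate values \<open>\<partial>\<^sub>2 F\<close> and \<open>\<partial>\<^sub>1 \<partial>\<^sub>2 F\<close>.\<close>

definition is_qpd :: "nat \<Rightarrow> nat \<Rightarrow> qpoly \<Rightarrow> qpoly \<Rightarrow> bool"
  where "is_qpd n k F H \<longleftrightarrow>
    (if k = 1 then is_divdiff n (qact n 1) 1 F H
     else \<exists>G G'. is_divdiff n (qact n 2) 2 F G \<and> is_divdiff n (qact n 1) 1 G G' \<and>
       is_divdiff n (qact n 2) 2 (F - qq n 1 2 * G') H)"

lemma is_qpd_2I:
  assumes "is_divdiff n (qact n 2) 2 F G" "is_divdiff n (qact n 1) 1 G G'"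
    and "is_divdiff n (qact n 2) 2 (F - qq n 1 2 * G') H"
  shows "is_qpd n 2 F H"
  using assms by (auto simp: is_qpd_def)

lemma is_qpd_2E:
  assumes "is_qpd n 2 F H"
  obtains G G' where "is_divdiff n (qact n 2) 2 F G" "is_divdiff n (qact n 1) 1 G G'"
    and "is_divdiff n (qact n 2) 2 (F - qq n 1 2 * G') H"
  using assms by (auto simp: is_qpd_def)

text \<open>Each intermediate quotient is unique, so the nested \<open>THE\<close> terms evaluate to
  the witnesses.\<close>

lemma qpd_eqI:
  assumes "is_qpd n k F H"
  shows "qpd n k F = H"
proof (cases "k = 1")
  case True
  with assms show ?thesis
    by (simp add: is_qpd_def qpd_def qpd1_def pd_def divdiff_eqI)
next
  case False
  with assms obtain G G' where
    "is_divdiff n (qact n 2) 2 F G" "is_divdiff n (qact n 1) 1 G G'"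
    "is_divdiff n (qact n 2) 2 (F - qq n 1 2 * G') H"
    unfolding is_qpd_def by auto
  then show ?thesis
    using False by (simp add: qpd_def qpd2_def pd_def divdiff_eqI)
qed

text \<open>For k = 2 the factor must be invariant under s_1 as well, since the correction term also
  applies \<partial>_1.\<close>

lemma is_qpd_mult:
  assumes "k \<in> {1, 2}" "P \<in> qring n" "\<And>l. 1 \<le> l \<Longrightarrow> l \<le> k \<Longrightarrow> qact n l P = P" "is_qpd n k F H"
  shows "is_qpd n k (P * F) (P * H)"
proof (cases "k = 1")
  case True
  with assms show ?thesis
    by (auto simp: is_qpd_def intro!: is_divdiff_mult qact.comm_ring_hom_axioms)
next
  case False
  then have k: "k = 2" using assms(1) by simp
  have inv: "qact n 1 P = P" "qact n 2 P = P"
    using assms(3) k by simp_all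
  from assms(4) obtain G G' where G: "is_divdiff n (qact n 2) 2 F G" "is_divdiff n (qact n 1) 1 G G'"
    "is_divdiff n (qact n 2) 2 (F - qq n 1 2 * G') H"
    unfolding k by (rule is_qpd_2E)
  have "P * F - qq n 1 2 * (P * G') = P * (F - qq n 1 2 * G')"
    by (simp add: algebra_simps)
  then show ?thesis
    unfolding k using G inv assms(2)
    by (intro is_qpd_2I[of n "P * F" "P * G" "P * G'"])
      (simp_all only: is_divdiff_mult[OF qact.comm_ring_hom_axioms])
qed

lemma is_qpd_scale:
  assumes "k \<in> {1, 2}" "is_qpd n k F H"
  shows "is_qpd n k (of_int a * F) (of_int a * H)"
  using assms by (intro is_qpd_mult) (simp_all add: qact.hom_of_int)

lemma is_qpd_zero: "is_qpd n k 0 0"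
  unfolding is_qpd_def using is_divdiff_zero[OF qact.comm_ring_hom_axioms]
  by (auto intro!: exI[of _ 0])

lemma is_qpd_add:
  assumes "k \<in> {1, 2}" "is_qpd n k F H" "is_qpd n k F' H'"
  shows "is_qpd n k (F + F') (H + H')"
proof (cases "k = 1")
  case True
  with assms show ?thesis
    by (auto simp: is_qpd_def intro!: is_divdiff_add qact.comm_ring_hom_axioms)
next
  case False
  then have k: "k = 2" using assms(1) by simp
  from assms(2) obtain G1 G2 where G: "is_divdiff n (qact n 2) 2 F G1" "is_divdiff n (qact n 1) 1 G1 G2"
    "is_divdiff n (qact n 2) 2 (F - qq n 1 2 * G2) H"
    unfolding k by (rule is_qpd_2E)
  from assms(3) obtain G1' G2' where G': "is_divdiff n (qact n 2) 2 F' G1'"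
    "is_divdiff n (qact n 1) 1 G1' G2'" "is_divdiff n (qact n 2) 2 (F' - qq n 1 2 * G2') H'"
    unfolding k by (rule is_qpd_2E)
  have "F + F' - qq n 1 2 * (G2 + G2') = (F - qq n 1 2 * G2) + (F' - qq n 1 2 * G2')"
    by (simp add: algebra_simps)
  then show ?thesis
    unfolding k using G G'
    by (intro is_qpd_2I[of n "F + F'" "G1 + G1'" "G2 + G2'"])
      (simp_all only: is_divdiff_add[OF qact.comm_ring_hom_axioms])
qed

lemma is_qpd_sum:
  assumes "k \<in> {1, 2}" "\<And>i. i \<in> A \<Longrightarrow> is_qpd n k (F i) (H i)"
  shows "is_qpd n k (\<Sum>i \<in> A. F i) (\<Sum>i \<in> A. H i)"
  using assms(2)
  by (induction A rule: infinite_finite_induct) (simp_all add: is_qpd_zero is_qpd_add[OF assms(1)])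

text \<open>Only the factor of level 1 moves, and it is 1, x_1 or 0 both classically and after
  quantization.\<close>

lemma divdiff_elem_product_1:
  assumes n: "1 < n"
  shows "\<exists>F G. quantizes n F G \<and> is_divdiff n (xact 1) 1 (elem_product elem n I) F \<and>
    is_qpd n 1 (elem_product (qelem n) n I) G"
proof -
  let ?P = "\<lambda>g. \<Prod>p \<in> {1..n-1} - {1}. g p (I p)"
  have prod: "elem_product g n I = ?P g * g 1 (I 1)" for g
    using n by (intro elem_product_remove) auto
  have inv: "xact 1 (?P elem) = ?P elem" "qact n 1 (?P (qelem n)) = ?P (qelem n)"
    by (auto simp: xact.hom_prod qact.hom_prod intro!: prod.cong xact_elem qact_qelem)
  have ring: "?P elem \<in> qring n" "?P (qelem n) \<in> qring n"
    by (auto intro!: qring_prod elem_in_qring qelem_in_qring)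
  consider "I 1 = 0" | "I 1 = 1" | "I 1 > 1" by linarith
  then show ?thesis
  proof cases
    case 1
    then show ?thesis
      unfolding prod using inv quantizes_0
      by (intro exI[of _ 0]) (auto simp: qelem_0 is_qpd_def
          intro!: is_divdiff_invariant xact.comm_ring_hom_axioms qact.comm_ring_hom_axioms)
  next
    case 2
    \<comment> \<open>Removing the factor of level 1 amounts to setting its index to 0.\<close>
    have P: "?P g = elem_product g n (I(1 := 0))" if "\<And>p. g p 0 = 1" for g
      using n that by (subst elem_product_remove[of 1]) (auto intro: prod.cong)
    have "quantizes n (?P elem) (?P (qelem n))"
      using P[of elem] P[of "qelem n"] quantizes_elem_product[of n "I(1 := 0)"]
      by (simp only: elem_0 qelem_0)
    moreover have "is_divdiff n (xact 1) 1 (elem 1 1) 1"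
      using is_divdiff_elem[of 1 n 0] n by simp
    then have "is_divdiff n (xact 1) 1 (?P elem * elem 1 1) (?P elem * 1)"
      by (intro is_divdiff_mult xact.comm_ring_hom_axioms inv ring)
    moreover have "is_divdiff n (qact n 1) 1 (qelem n 1 1) 1"
      unfolding qelem_1_1 by (simp add: is_divdiff_def)
    then have "is_divdiff n (qact n 1) 1 (?P (qelem n) * qelem n 1 1) (?P (qelem n) * 1)"
      by (intro is_divdiff_mult qact.comm_ring_hom_axioms inv ring)
    ultimately show ?thesis
      unfolding prod 2 is_qpd_def by (simp only: mult_1_right simp_thms if_True) blast
  next
    case 3
    then show ?thesis
      unfolding prod using quantizes_0 is_qpd_zero is_divdiff_zero[OF xact.comm_ring_hom_axioms]
      by (intro exI[of _ 0]) (simp add: elem_eq_0 qelem_def)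
  qed
qed

lemma elem_2_1: "elem 2 1 = xx 1 + xx 2"
  and elem_2_2: "elem 2 2 = xx 1 * xx 2"
  and elem_1_1: "elem 1 1 = xx 1"
  by (simp_all add: numeral_2_eq_2 elem_Suc_Suc elem_eq_0)

lemma qact_qq_1_2:
  assumes "2 \<le> n"
  shows "qact n 1 (qq n 1 2) = qq n 1 2" "qact n 2 (qq n 1 2) = qq n 1 2"
  using assms by (simp_all add: qact_qq) (simp add: qq_def)

text \<open>The only case where the quantum correction \<open>q\<^sub>1\<^sub>2 \<partial>\<^sub>1 \<partial>\<^sub>2\<close> matters for the result is
  the last one: \<open>x\<^sub>1\<^sup>2\<close> is straightened to \<open>e\<^sub>1\<^sup>(\<^sup>1\<^sup>) e\<^sub>1\<^sup>(\<^sup>2\<^sup>) - e\<^sub>2\<^sup>(\<^sup>2\<^sup>)\<close>, whose quantization is \<open>x\<^sub>1\<^sup>2 - q\<^sub>1\<^sub>2\<close>.\<close>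

lemma divdiff_elem_product_2:
  assumes n: "2 < n"
  shows "\<exists>F G. quantizes n F G \<and> is_divdiff n (xact 2) 2 (elem_product elem n I) F \<and>
    is_qpd n 2 (elem_product (qelem n) n I) G"
proof -
  let ?P = "\<lambda>g. \<Prod>p \<in> {1..n-1} - {1, 2}. g p (I p)"
  have prod: "?P g * (g 1 a * g 2 b) = elem_product g n (I(1 := a, 2 := b))" for g a b
    using elem_product_remove2[of 1 n g I a b] n by (simp add: mult.assoc numeral_2_eq_2)
  have prod_I: "elem_product g n I = ?P g * (g 1 (I 1) * g 2 (I 2))" for g
    unfolding prod by (simp only: fun_upd_triv)
  have inv: "xact 2 (?P elem) = ?P elem" "qact n 1 (?P (qelem n)) = ?P (qelem n)"
    "qact n 2 (?P (qelem n)) = ?P (qelem n)"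
    by (auto simp: xact.hom_prod qact.hom_prod intro!: prod.cong xact_elem qact_qelem)
  have ring: "?P elem \<in> qring n" "?P (qelem n) \<in> qring n"
    by (auto intro!: qring_prod elem_in_qring qelem_in_qring)
  have qz: "quantizes n (?P elem * (elem 1 a * elem 2 b)) (?P (qelem n) * (qelem n 1 a * qelem n 2 b))" for a b
    unfolding prod by (rule quantizes_elem_product)
  \<comment> \<open>All levels above 2 are invariant under s_1 and s_2, so the factors of levels 1
    and 2 decide.\<close>
  have reduce: ?thesis
    if "quantizes n (?P elem * R) (?P (qelem n) * R')"
      and "is_divdiff n (xact 2) 2 (elem 1 (I 1) * elem 2 (I 2)) R"
      and "is_qpd n 2 (qelem n 1 (I 1) * qelem n 2 (I 2)) R'" for R R'
  proof -
    have "is_divdiff n (xact 2) 2 (elem_product elem n I) (?P elem * R)"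
      unfolding prod_I by (intro is_divdiff_mult xact.comm_ring_hom_axioms inv ring that)
    moreover have "is_qpd n 2 (elem_product (qelem n) n I) (?P (qelem n) * R')"
      unfolding prod_I
    proof (rule is_qpd_mult)
      fix l :: nat assume "1 \<le> l" "l \<le> 2"
      then have "l = 1 \<or> l = 2" by auto
      then show "qact n l (?P (qelem n)) = ?P (qelem n)" using inv by blast
    qed (use ring that in auto)
    ultimately show ?thesis using that(1) by blast
  qed
  note defs = is_divdiff_def qact.hom_mult qact.hom_add qact.hom_minus xact.hom_mult xact.hom_add
    qact_qq_1_2[simplified] elem_1_1[simplified] elem_2_1[simplified] elem_2_2 qelem_0
    qelem_1_1[simplified] qelem_2_1[simplified] qelem_2_2[simplified] transpose_def qring_intros
  have n2: "2 \<le> n" using n by simp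
  consider "I 1 > 1 \<or> I 2 > 2" | "I 2 = 0" | "I 1 = 0" "I 2 = 1" | "I 1 = 0" "I 2 = 2"
    | "I 1 = 1" "I 2 = 1" | "I 1 = 1" "I 2 = 2" by linarith
  then show ?thesis
  proof cases
    case 1
    then have e: "elem 1 (I 1) * elem 2 (I 2) = 0" "qelem n 1 (I 1) * qelem n 2 (I 2) = 0"
      by (auto simp: elem_eq_0 qelem_def)
    show ?thesis
      by (rule reduce[of 0 0])
        (simp_all only: e mult_zero_right quantizes_0 is_qpd_zero
          is_divdiff_zero[OF xact.comm_ring_hom_axioms])
  next
    case 2
    \<comment> \<open>Only level 1 remains, which s_2 fixes; already the inner \<partial>_2 gives
      0.\<close>
    have "is_divdiff n (xact 2) 2 (elem 1 (I 1) * elem 2 (I 2)) 0"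
      by (intro is_divdiff_invariant xact.comm_ring_hom_axioms) (simp add: 2 xact_elem_less)
    moreover have "is_divdiff n (qact n 2) 2 (qelem n 1 (I 1) * qelem n 2 (I 2)) 0"
      using n2 by (intro is_divdiff_invariant qact.comm_ring_hom_axioms) (simp add: 2 qelem_0 qact_qelem)
    then have "is_qpd n 2 (qelem n 1 (I 1) * qelem n 2 (I 2)) 0"
      by (intro is_qpd_2I[where G = 0 and G' = 0])
        (simp_all only: mult_zero_right diff_zero is_divdiff_zero[OF qact.comm_ring_hom_axioms])
    ultimately show ?thesis
      by (intro reduce[of 0 0]) (simp_all only: mult_zero_right quantizes_0)
  next
    case 3
    show ?thesis
    proof (rule reduce[of 1 1])
      show "quantizes n (?P elem * 1) (?P (qelem n) * 1)"
        using qz[of 0 0] by (simp add: qelem_0)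
      show "is_divdiff n (xact 2) 2 (elem 1 (I 1) * elem 2 (I 2)) 1"
        unfolding 3 by (simp add: defs)
      show "is_qpd n 2 (qelem n 1 (I 1) * qelem n 2 (I 2)) 1"
        unfolding 3 using n2 by (intro is_qpd_2I[where G = 1 and G' = 0]) (simp_all add: defs)
    qed
  next
    case 4
    show ?thesis
    proof (rule reduce[of "xx 1" "xx 1"])
      show "quantizes n (?P elem * xx 1) (?P (qelem n) * xx 1)"
        using qz[of 1 0] elem_1_1 qelem_1_1 by (simp add: qelem_0)
      show "is_divdiff n (xact 2) 2 (elem 1 (I 1) * elem 2 (I 2)) (xx 1)"
        unfolding 4 using n2 by (simp add: defs algebra_simps)
      \<comment> \<open>The correction is q_12 times \<partial>_1 x_1 = 1, and q_12 is
        s_2-invariant, so the outer \<partial>_2 kills it.\<close>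
      show "is_qpd n 2 (qelem n 1 (I 1) * qelem n 2 (I 2)) (xx 1)"
        unfolding 4 using n2
        by (intro is_qpd_2I[where G = "xx 1" and G' = 1]) (simp_all add: defs algebra_simps)
    qed
  next
    case 5
    show ?thesis
    proof (rule reduce[of "xx 1" "xx 1"])
      show "quantizes n (?P elem * xx 1) (?P (qelem n) * xx 1)"
        using qz[of 1 0] elem_1_1 qelem_1_1 by (simp add: qelem_0)
      show "is_divdiff n (xact 2) 2 (elem 1 (I 1) * elem 2 (I 2)) (xx 1)"
        unfolding 5 using n2 by (simp add: defs algebra_simps)
      show "is_qpd n 2 (qelem n 1 (I 1) * qelem n 2 (I 2)) (xx 1)"
        unfolding 5 using n2
        by (intro is_qpd_2I[where G = "xx 1" and G' = 1]) (simp_all add: defs algebra_simps)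
    qed
  next
    case 6
    show ?thesis
    proof (rule reduce[of "xx 1 * xx 1" "xx 1 * xx 1 - qq n 1 2"])
      have "elem 1 1 * elem 2 1 - elem 1 0 * elem 2 2 = xx 1 * xx 1"
        "qelem n 1 1 * qelem n 2 1 - qelem n 1 0 * qelem n 2 2 = xx 1 * xx 1 - qq n 1 2"
        unfolding elem_1_1 elem_2_1 elem_2_2 qelem_1_1 qelem_2_1[OF n2] qelem_2_2[OF n2]
        by (simp_all add: qelem_0 algebra_simps)
      then show "quantizes n (?P elem * (xx 1 * xx 1)) (?P (qelem n) * (xx 1 * xx 1 - qq n 1 2))"
        using quantizes_diff[OF qz[of 1 1] qz[of 0 2]] by (simp only: flip: right_diff_distrib)
      show "is_divdiff n (xact 2) 2 (elem 1 (I 1) * elem 2 (I 2)) (xx 1 * xx 1)"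
        unfolding 6 using n2 by (simp add: defs algebra_simps)
      \<comment> \<open>From F = x_1 (x_1 x_2 + q_12) one gets \<partial>_2 F = x_1^2 and then x_1 +
        x_2. Subtracting q_12 (x_1 + x_2) leaves x_1^2 x_2 - q_12 x_2, to which the outer
        \<partial>_2 applies.\<close>
      show "is_qpd n 2 (qelem n 1 (I 1) * qelem n 2 (I 2)) (xx 1 * xx 1 - qq n 1 2)"
        unfolding 6 using n2
        by (intro is_qpd_2I[where G = "xx 1 * xx 1" and G' = "xx 1 + xx 2"])
          (simp_all add: defs algebra_simps, simp add: numeral_2_eq_2)
    qed
  qed
qed

section \<open>Quantization intertwines the divided differences\<close>

lemma quantizes_qpd:
  assumes "quantizes n F G" and k: "k \<in> {1, 2}" "k \<le> n - 1"
  shows "quantizes n (xpd n k F) (qpd n k G)"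
proof -
  obtain c where
    F: "F = (\<Sum>I \<in> elem_indices n. of_int (c I) * elem_product elem n I)" and
    G: "G = (\<Sum>I \<in> elem_indices n. of_int (c I) * elem_product (qelem n) n I)"
    using assms(1) unfolding quantizes_def by blast
  have "k < n" using k by auto
  \<comment> \<open>The monomial cases supply values for each I, which are then combined with the
    common coefficients c.\<close>
  then have "\<forall>I. \<exists>F G. quantizes n F G \<and> is_divdiff n (xact k) k (elem_product elem n I) F \<and>
      is_qpd n k (elem_product (qelem n) n I) G"
    using k(1) divdiff_elem_product_1 divdiff_elem_product_2 by blast
  then obtain D E where DE: "quantizes n (D I) (E I)"
    "is_divdiff n (xact k) k (elem_product elem n I) (D I)"
    "is_qpd n k (elem_product (qelem n) n I) (E I)" for I
    by metis
  let ?D = "\<Sum>I \<in> elem_indices n. of_int (c I) * D I"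
    and ?E = "\<Sum>I \<in> elem_indices n. of_int (c I) * E I"
  have "is_divdiff n (xact k) k F ?D"
    unfolding F by (intro is_divdiff_sum is_divdiff_of_int_mult DE xact.comm_ring_hom_axioms)
  moreover have "is_qpd n k G ?E"
    unfolding G by (intro is_qpd_sum is_qpd_scale DE k)
  moreover have "quantizes n ?D ?E"
    by (intro quantizes_sum quantizes_scale DE)
  ultimately show ?thesis
    by (simp add: xpd_def divdiff_eqI qpd_eqI)
qed

text \<open>Linear independence leaves only zero coefficients; this settles the ascent case.\<close>

lemma quantizes_zero_unique:
  assumes "quantizes n 0 G"
  shows "G = 0"
proof -
  obtain c where c: "0 = (\<Sum>I \<in> elem_indices n. of_int (c I) * elem_product elem n I)"
    "G = (\<Sum>I \<in> elem_indices n. of_int (c I) * elem_product (qelem n) n I)"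
    using assms unfolding quantizes_def by blast
  have "c I = 0" if "I \<in> elem_indices n" for I
    using elem_product_coeff_unique[of c n "\<lambda>_. 0" I] c(1) that by simp
  with c(2) show ?thesis by simp
qed

lemma quantizes_schubert: "w permutes {1..n} \<Longrightarrow> quantizes n (schubert n w) (qschubert n w)"
  using schubert_in_span[of w n] quantizes_schubert_unique[of n w] unfolding elem_span_def by blast

theorem corollary10p11:
  fixes n k :: nat and w :: "nat \<Rightarrow> nat"
  assumes "w permutes {1..n}" and "k \<in> {1, 2}" and "k \<le> n - 1"
  shows "(w k > w (k + 1) \<longrightarrow> qpd n k (qschubert n w) = qschubert n (w \<circ> adj_transp k)) \<and>
         (w k < w (k + 1) \<longrightarrow> qpd n k (qschubert n w) = 0)"
proof (intro conjI impI)
  have k: "1 \<le> k" "k < n"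
    using assms(2,3) by auto
  have step: "quantizes n (xpd n k (schubert n w)) (qpd n k (qschubert n w))"
    by (rule quantizes_qpd[OF quantizes_schubert[OF assms(1)] assms(2,3)])
  {
    assume "w k > w (k + 1)"
    with step show "qpd n k (qschubert n w) = qschubert n (w \<circ> adj_transp k)"
      by (simp only: schubert_descent[OF assms(1) k, symmetric] quantizes_schubert_unique)
  next
    assume "w k < w (k + 1)"
    with step show "qpd n k (qschubert n w) = 0"
      by (simp only: schubert_ascent[OF assms(1) k] quantizes_zero_unique)
  }
qed

end
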